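(* Let $g=(A,v)\in \mathrm{Aff}(n,\mathbb{C})$. The following are equivalent: (i) $g$ is $c$-reversible in $\mathrm{Aff}(n,\mathbb{C})$; (ii) $g$ is strongly $c$-reversible in $\mathrm{Aff}(n,\mathbb{C})$, i.e. $g$ is a product of two coninvolutions in $\mathrm{Aff}(n,\mathbb{C})$; (iii) the linear part $L(g)=A$ is $c$-reversible in $\mathrm{GL}(n,\mathbb{C})$, i.e. there is $B\in\mathrm{GL}(n,\mathbb{C})$ with $BAB^{-1}=\overline{A}^{-1}$.
   Context: $\mathrm{Aff}(n,\mathbb{C})=\mathrm{GL}(n,\mathbb{C})\ltimes\mathbb{C}^n$ is the group of affine maps $z\mapsto Az+v$ of $\mathbb{C}^n$, written $g=(A,v)$ with $A\in\mathrm{GL}(n,\mathbb{C})$, $v\in\mathbb{C}^n$; the product is composition, $(A,v)(B,w)=(AB,Aw+v)$, the identity is $e=(I_n,0)$, and $L(g)=A$ is the linear part. For $g=(A,v)$ set $\overline{g}=(\overline{A},\overline{v})$ (entrywise complex conjugation). An element $h\in\mathrm{Aff}(n,\mathbb{C})$ is a coninvolution if $h\overline{h}=e$. An element $g$ is $c$-reversible if there is $h\in\mathrm{Aff}(n,\mathbb{C})$ with $hgh^{-1}=\overline{g}^{-1}$, and strongly $c$-reversible if such $h$ can be chosen to be a coninvolution. A matrix $A\in\mathrm{GL}(n,\mathbb{C})$ is $c$-reversible in $\mathrm{GL}(n,\mathbb{C})$ if it is conjugate in $\mathrm{GL}(n,\mathbb{C})$ to $\overline{A}^{-1}$. *)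

theory Defs
  imports "HOL-Analysis.Analysis"
begin

text \<open>Elements of Aff(n,C) are pairs (A,v) with A an invertible complex n x n matrix
  (n = CARD('n)), acting as z \<mapsto> A z + v.\<close>

type_synonym 'n aff = "(complex^'n^'n) \<times> (complex^'n)"

definition in_Aff :: "'n::finite aff \<Rightarrow> bool" where
  "in_Aff g \<longleftrightarrow> invertible (fst g)"

definition aff_mult :: "'n::finite aff \<Rightarrow> 'n aff \<Rightarrow> 'n aff" where
  "aff_mult g h = (fst g ** fst h, fst g *v snd h + snd g)"

definition aff_id :: "'n::finite aff" where
  "aff_id = (mat 1, 0)"

definition aff_inv :: "'n::finite aff \<Rightarrow> 'n aff" where
  "aff_inv g = (matrix_inv (fst g), - (matrix_inv (fst g) *v snd g))"

definition cnj_vec :: "complex^'n \<Rightarrow> complex^'n" where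
  "cnj_vec v = (\<chi> i. cnj (v $ i))"

definition cnj_mat :: "complex^'n^'m \<Rightarrow> complex^'n^'m" where
  "cnj_mat A = (\<chi> i j. cnj (A $ i $ j))"

definition aff_cnj :: "'n::finite aff \<Rightarrow> 'n aff" where
  "aff_cnj g = (cnj_mat (fst g), cnj_vec (snd g))"

definition coninvolution :: "'n::finite aff \<Rightarrow> bool" where
  "coninvolution h \<longleftrightarrow> in_Aff h \<and> aff_mult h (aff_cnj h) = aff_id"

definition c_reversible_aff :: "'n::finite aff \<Rightarrow> bool" where
  "c_reversible_aff g \<longleftrightarrow>
     (\<exists>h. in_Aff h \<and> aff_mult (aff_mult h g) (aff_inv h) = aff_inv (aff_cnj g))"

definition strongly_c_reversible_aff :: "'n::finite aff \<Rightarrow> bool" where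
  "strongly_c_reversible_aff g \<longleftrightarrow>
     (\<exists>h. coninvolution h \<and> aff_mult (aff_mult h g) (aff_inv h) = aff_inv (aff_cnj g))"

definition c_reversible_GL :: "complex^'n^'n \<Rightarrow> bool" where
  "c_reversible_GL A \<longleftrightarrow>
     (\<exists>B. invertible B \<and> B ** A ** matrix_inv B = matrix_inv (cnj_mat A))"

end

theory Submission
  imports Defs "HOL-Computational_Algebra.Fundamental_Theorem_Algebra"
begin

text \<open>
  Write \<open>s = conj \<circ> h\<close>. Then \<open>h g h\<^sup>-\<^sup>1\<close> is the conjugate of \<open>g\<^sup>-\<^sup>1\<close> iff the anti-affine map \<open>s\<close> satisfies
  \<open>s g s\<^sup>-\<^sup>1 = g\<^sup>-\<^sup>1\<close>, and \<open>h\<close> is a coninvolution iff \<open>s\<^sup>2 = 1\<close>. In homogeneous coordinates \<open>g\<close> is a linear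
  map \<open>G\<close> of \<open>C\<^sup>n\<^sup>+\<^sup>1\<close> with \<open>\<phi> \<circ> G = \<phi>\<close>, where \<open>\<phi>\<close> is the last coordinate. A Cayley transform
  replaces \<open>G\<close> by a linear map \<open>N\<close> with \<open>\<phi> \<circ> N = 0\<close>, and antilinear maps reversing \<open>G\<close> are
  those commuting with \<open>N\<close>. So one needs an antilinear involution \<open>S\<close> commuting with \<open>N\<close> such
  that \<open>\<phi> \<circ> S\<close> is the conjugate of \<open>\<phi>\<close>, given some injective antilinear \<open>T\<close> commuting with \<open>N\<close>
  on the kernel of \<open>\<phi>\<close>.

  The generalized eigenspaces of a non-real pair \<open>\<lambda>\<close>, \<open>cnj \<lambda>\<close> lie in the kernel of \<open>\<phi>\<close> and are swapped by
  \<open>T\<close>; let \<open>S\<close> be \<open>T\<close> on one and \<open>T\<^sup>-\<^sup>1\<close> on the other. On the real part of the spectrum, split off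
  Jordan chains, the first of them with a generator \<open>u\<close> such that \<open>\<phi> u = 1\<close> if \<open>\<phi> \<noteq> 0\<close>, and let \<open>S\<close> be
  complex conjugation of the coefficients in the resulting basis.
\<close>

section \<open>Linear algebra over the complex numbers\<close>

abbreviation clin :: "(complex^'m \<Rightarrow> complex^'m) \<Rightarrow> bool" where
  "clin \<equiv> Vector_Spaces.linear (*s) (*s)"

lemma clinI:
  assumes "\<And>x y. f (x + y) = f x + f y" "\<And>c x. f (c *s x) = c *s f x"
  shows "clin f"
  using assms by (simp add: Vector_Spaces.linear_iff vec.vector_space_axioms)

lemma clin_add: "clin f \<Longrightarrow> f (x + y) = f x + f y"
  and clin_scale: "clin f \<Longrightarrow> f (c *s x) = c *s f x"
  by (simp_all add: Vector_Spaces.linear_iff)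

lemma clin_0: "clin f \<Longrightarrow> f 0 = 0"
  using clin_scale[of f 0 0] by simp

lemma clin_diff: "clin f \<Longrightarrow> f (x - y) = f x - f y"
  by (metis clin_add diff_add_cancel add_diff_cancel_right')

lemma clin_sum: "clin f \<Longrightarrow> f (\<Sum>i\<in>A. g i) = (\<Sum>i\<in>A. f (g i))"
  by (induction A rule: infinite_finite_induct) (auto simp: clin_0 clin_add)

lemma clin_funpow: "clin f \<Longrightarrow> clin (f ^^ n)"
  by (induction n) (auto intro!: clinI simp: clin_add clin_scale)

lemma clin_shift: "clin f \<Longrightarrow> clin (\<lambda>x. f x - l *s x)"
  by (rule clinI) (simp_all add: clin_add clin_scale vec.scale_right_distrib vec.scale_right_diff_distrib vec.scale_left_commute)

lemma clin_subspace_image: "clin f \<Longrightarrow> vec.subspace V \<Longrightarrow> vec.subspace (f ` V)"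
  by (rule vec.linear_subspace_image)

lemma clin_subspace_kernel:
  assumes "clin f" "vec.subspace V" shows "vec.subspace {x\<in>V. f x = 0}"
  using assms by (auto simp: vec.subspace_def clin_0 clin_add clin_scale)

section \<open>Iterates and the Fitting decomposition\<close>

lemma funpow_in:
  assumes "\<And>x. x \<in> V \<Longrightarrow> f x \<in> V" "x \<in> V" shows "(f ^^ n) x \<in> V"
  using assms(2) by (induction n) (auto intro: assms(1))

lemma funpow_commute:
  assumes "\<And>x. x \<in> V \<Longrightarrow> f x \<in> V" "\<And>x. x \<in> V \<Longrightarrow> g (f x) = h (g x)" "x \<in> V"
  shows "g ((f ^^ n) x) = (h ^^ n) (g x)"
  by (induction n) (use assms in \<open>auto simp: funpow_in\<close>)

lemma funpow_add_apply: "(f ^^ (m + n)) x = (f ^^ m) ((f ^^ n) x)"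
  by (simp add: funpow_add)

text \<open>Images of the powers of \<open>M\<close> shrink and kernels grow, so bounded dimension
  makes both stabilise; \<open>m\<close> lies past both points. The conclusions say that
  \<open>V\<close> is the direct sum of the kernel and the image of \<open>M ^^ m\<close> on
  \<open>V\<close>.\<close>

lemma fitting:
  fixes M :: "complex^'m \<Rightarrow> complex^'m"
  assumes M: "clin M" and V: "vec.subspace V" and inv: "\<And>x. x \<in> V \<Longrightarrow> M x \<in> V"
  obtains m where "m > 0"
    and "\<And>x. x \<in> V \<Longrightarrow> \<exists>y\<in>V. (M ^^ m) x = (M ^^ m) ((M ^^ m) y)"
    and "\<And>x j. x \<in> V \<Longrightarrow> (M ^^ j) x = 0 \<Longrightarrow> (M ^^ m) x = 0"
proof -
  define R where "R i = (M ^^ i) ` V" for i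
  define Z where "Z i = {x\<in>V. (M ^^ i) x = 0}" for i
  have Rsub: "vec.subspace (R i)" for i
    unfolding R_def by (intro clin_subspace_image clin_funpow M V)
  have Zsub: "vec.subspace (Z i)" for i
    unfolding Z_def by (intro clin_subspace_kernel clin_funpow M V)
  have Rmono: "R j \<subseteq> R i" if "i \<le> j" for i j
  proof
    fix y assume "y \<in> R j"
    then obtain x where x: "x \<in> V" "y = (M ^^ j) x" by (auto simp: R_def)
    have "y = (M ^^ i) ((M ^^ (j - i)) x)"
      using that x by (simp flip: funpow_add_apply)
    then show "y \<in> R i"
      using funpow_in[of V M, OF inv x(1)] by (auto simp: R_def)
  qed
  have Zmono: "Z i \<subseteq> Z j" if "i \<le> j" for i j
  proof
    fix x assume x: "x \<in> Z i"
    have "(M ^^ j) x = (M ^^ (j - i)) ((M ^^ i) x)"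
      using that by (simp flip: funpow_add_apply)
    then show "x \<in> Z j"
      using x by (simp add: Z_def clin_0[OF clin_funpow[OF M]])
  qed
  obtain a where a: "\<And>i. vec.dim (R a) \<le> vec.dim (R i)"
    using ex_has_least_nat[of "\<lambda>_. True" 0 "\<lambda>i. vec.dim (R i)"] by auto
  have Zbd: "vec.dim (Z i) < Suc (vec.dim V)" for i
    using vec.dim_subset[of "Z i" V] by (auto simp: Z_def)
  obtain b where b: "\<And>i. vec.dim (Z i) \<le> vec.dim (Z b)"
    using ex_has_greatest_nat[of "\<lambda>_. True" 0 "\<lambda>i. vec.dim (Z i)" "Suc (vec.dim V)"] Zbd
    by (auto simp: less_imp_le)
  \<comment> \<open>The successor makes \<open>m\<close> positive even when both sequences are
    constant from the start.\<close>
  define m where "m = Suc (max a b)"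
  have Req: "R j = R a" if "a \<le> j" for j
    using vec.subspace_dim_equal[OF Rsub Rsub Rmono[OF that] a] .
  have Zeq: "Z b = Z j" if "b \<le> j" for j
    using vec.subspace_dim_equal[OF Zsub Zsub Zmono[OF that] b] .
  show thesis
  proof (rule that[of m])
    show "m > 0" by (simp add: m_def)
    show "\<exists>y\<in>V. (M ^^ m) x = (M ^^ m) ((M ^^ m) y)" if "x \<in> V" for x
    proof -
      have "R m = R (m + m)"
        using Req[of m] Req[of "m + m"] by (simp add: m_def)
      then have "(M ^^ m) x \<in> R (m + m)" using that by (auto simp: R_def)
      then show ?thesis by (auto simp: R_def funpow_add)
    qed
    show "(M ^^ m) x = 0" if "x \<in> V" "(M ^^ j) x = 0" for x j
    proof -
      have "x \<in> Z (max j b)" using that Zmono[of j "max j b"] by (auto simp: Z_def)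
      then have "x \<in> Z m" using Zeq[of "max j b"] Zeq[of m] by (simp add: m_def)
      then show ?thesis by (simp add: Z_def)
    qed
  qed
qed

text \<open>A basis of \<open>W\<close> stays independent after adding \<open>u\<close>, so some
  linear map vanishes on \<open>W\<close> and sends \<open>u\<close> to the all-ones vector; any
  coordinate of it is the functional.\<close>

lemma functional_separating_subspace:
  fixes W :: "(complex^'m) set"
  assumes W: "vec.subspace W" and u: "u \<notin> W"
  obtains \<phi> :: "complex^'m \<Rightarrow> complex"
  where "\<And>x y. \<phi> (x + y) = \<phi> x + \<phi> y" "\<And>c x. \<phi> (c *s x) = c * \<phi> x"
    "\<phi> u = 1" "\<And>w. w \<in> W \<Longrightarrow> \<phi> w = 0"
proof -
  obtain B where B: "B \<subseteq> W" "vec.independent B" "W \<subseteq> vec.span B"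
    by (rule vec.basis_exists[of W]) simp
  have BW: "vec.span B = W" using B W by (metis vec.span_minimal subset_antisym)
  have uB: "u \<notin> B" using u B by blast
  have "vec.independent (insert u B)" using vec.independent_insertI B(2) u BW by blast
  then obtain f where f: "clin f"
    "\<forall>x\<in>insert u B. f x = (if x = u then (\<chi> i. 1) else 0)"
    using vec.linear_independent_extend[of "insert u B" "\<lambda>x. if x = u then (\<chi> i. 1) else 0"] by blast
  have f0: "f w = 0" if "w \<in> W" for w
    using vec.linear_eq_0_on_span[OF f(1), of B w] that f(2) uB BW by fastforce
  obtain i :: 'm where True by blast
  show thesis
    by (rule that[of "\<lambda>x. f x $ i"]) (use f f0 in \<open>auto simp: clin_add clin_scale\<close>)
qed

section \<open>Real structures commuting with a linear map\<close>

text \<open>The functional \<open>\<phi>\<close> carries the affine structure: it will be the last homogeneous coordinate,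
  and compatibility with it makes \<open>S\<close> descend to an anti-affine map of the hyperplane \<open>\<phi> = 1\<close>.\<close>

definition real_str ::
  "(complex^'m \<Rightarrow> complex^'m) \<Rightarrow> (complex^'m \<Rightarrow> complex) \<Rightarrow> (complex^'m) set \<Rightarrow>
   (complex^'m \<Rightarrow> complex^'m) \<Rightarrow> bool" where
  "real_str N \<phi> V S \<longleftrightarrow>
     (\<forall>x\<in>V. S x \<in> V \<and> S (S x) = x \<and> S (N x) = N (S x) \<and> \<phi> (S x) = cnj (\<phi> x)) \<and>
     (\<forall>x\<in>V. \<forall>y\<in>V. S (x + y) = S x + S y) \<and> (\<forall>c. \<forall>x\<in>V. S (c *s x) = cnj c *s S x)"

text \<open>The sum is direct, so \<open>S1\<close> and \<open>S2\<close> combine componentwise into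
  a well-defined map; both summands are \<open>N\<close>-invariant, so commutation with
  \<open>N\<close> can be checked on each.\<close>

lemma real_str_glue:
  assumes N: "clin N" and \<phi>: "\<And>x y. \<phi> (x + y) = \<phi> x + \<phi> y"
    and V1: "vec.subspace V1" and V2: "vec.subspace V2"
    and inv1: "\<And>x. x \<in> V1 \<Longrightarrow> N x \<in> V1" and inv2: "\<And>x. x \<in> V2 \<Longrightarrow> N x \<in> V2"
    and disj: "\<And>x. x \<in> V1 \<Longrightarrow> x \<in> V2 \<Longrightarrow> x = 0"
    and sum: "\<And>x y. x \<in> V1 \<Longrightarrow> y \<in> V2 \<Longrightarrow> x + y \<in> V"
      "\<And>z. z \<in> V \<Longrightarrow> \<exists>x\<in>V1. \<exists>y\<in>V2. z = x + y"
    and S1: "real_str N \<phi> V1 S1" and S2: "real_str N \<phi> V2 S2"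
  shows "\<exists>S. real_str N \<phi> V S"
proof -
  define S where "S z = (THE w. \<exists>x\<in>V1. \<exists>y\<in>V2. z = x + y \<and> w = S1 x + S2 y)" for z
  have uniq: "x = x' \<and> y = y'"
    if "x \<in> V1" "x' \<in> V1" "y \<in> V2" "y' \<in> V2" "x + y = x' + y'" for x x' y y'
  proof -
    have eq: "x - x' = y' - y" using that(5) by (simp add: algebra_simps)
    have "x - x' \<in> V1" "y' - y \<in> V2" using that V1 V2 by (auto intro: vec.subspace_diff)
    then have "x - x' = 0" using disj eq by metis
    then show ?thesis using eq by simp
  qed
  have S: "S (x + y) = S1 x + S2 y" if "x \<in> V1" "y \<in> V2" for x y
    unfolding S_def
  proof (rule the_equality)
    show "\<exists>x'\<in>V1. \<exists>y'\<in>V2. x + y = x' + y' \<and> S1 x + S2 y = S1 x' + S2 y'" using that by blast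
  next
    fix w assume "\<exists>x'\<in>V1. \<exists>y'\<in>V2. x + y = x' + y' \<and> w = S1 x' + S2 y'"
    then show "w = S1 x + S2 y" using uniq that by metis
  qed
  note s1 = S1[unfolded real_str_def] and s2 = S2[unfolded real_str_def]
  have "real_str N \<phi> V S"
    unfolding real_str_def
  proof (intro conjI ballI allI)
    fix z assume "z \<in> V"
    then obtain x y where z: "z = x + y" "x \<in> V1" "y \<in> V2" using sum(2) by blast
    have Sz: "S z = S1 x + S2 y" using S z by simp
    have in1: "S1 x \<in> V1" and in2: "S2 y \<in> V2" using s1 s2 z by auto
    show "S z \<in> V" using Sz in1 in2 sum(1) by simp
    show "S (S z) = z" using Sz S[OF in1 in2] s1 s2 z by simp
    have "S (N z) = S1 (N x) + S2 (N y)"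
      using S[OF inv1 inv2] z by (simp add: clin_add[OF N])
    then show "S (N z) = N (S z)" using s1 s2 z Sz by (simp add: clin_add[OF N])
    show "\<phi> (S z) = cnj (\<phi> z)" using s1 s2 z Sz by (simp add: \<phi>)
    fix c
    have "S (c *s x + c *s y) = S1 (c *s x) + S2 (c *s y)"
      using S vec.subspace_scale V1 V2 z by blast
    then show "S (c *s z) = cnj c *s S z"
      using s1 s2 z Sz by (simp add: vec.scale_right_distrib)
  next
    fix z z' assume "z \<in> V" "z' \<in> V"
    then obtain x y x' y' where z: "z = x + y" "x \<in> V1" "y \<in> V2"
      "z' = x' + y'" "x' \<in> V1" "y' \<in> V2" using sum(2) by meson
    have "S ((x + x') + (y + y')) = S1 (x + x') + S2 (y + y')"
      using S vec.subspace_add V1 V2 z by blast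
    moreover have "z + z' = (x + x') + (y + y')" using z by (simp add: algebra_simps)
    ultimately show "S (z + z') = S z + S z'"
      using S z s1 s2 by (simp add: algebra_simps)
  qed
  then show ?thesis by blast
qed

section \<open>Jordan chains and their invariant complements\<close>

text \<open>The polynomial in \<open>M\<close> of degree at most \<open>k\<close> with coefficients
  \<open>c\<close>, applied to \<open>u\<close>. Values of \<open>c\<close> beyond \<open>k\<close>
  are ignored, so coefficients are only ever compared up to \<open>k\<close>.\<close>

definition cyc :: "(complex^'m \<Rightarrow> complex^'m) \<Rightarrow> nat \<Rightarrow> complex^'m \<Rightarrow> (nat \<Rightarrow> complex) \<Rightarrow> complex^'m" where
  "cyc M k u c = (\<Sum>i\<le>k. c i *s (M ^^ i) u)"

text \<open>If \<open>M\<^sup>k u\<close> is not in the image of \<open>M\<^sup>k\<^sup>+\<^sup>1\<close>, pick a functional \<open>\<phi>\<close> killing that image with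
  \<open>\<phi> (M\<^sup>k u) = 1\<close>; the complement of the Jordan chain of \<open>u\<close> is the common kernel of the \<open>\<phi> \<circ> M\<^sup>i\<close>, \<open>i \<le> k\<close>.\<close>

lemma cyclic_complement:
  fixes M :: "complex^'m \<Rightarrow> complex^'m"
  assumes M: "clin M" and V: "vec.subspace V" and inv: "\<And>x. x \<in> V \<Longrightarrow> M x \<in> V"
    and u: "u \<in> V" "(M ^^ Suc k) u = 0" "(M ^^ k) u \<notin> (M ^^ Suc k) ` V"
  obtains K where "vec.subspace K" "K \<subseteq> V" "u \<notin> K" "\<And>x. x \<in> K \<Longrightarrow> M x \<in> K"
    "\<And>c i. cyc M k u c \<in> K \<Longrightarrow> i \<le> k \<Longrightarrow> c i = 0"
    "\<And>x. x \<in> V \<Longrightarrow> \<exists>c. x - cyc M k u c \<in> K"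
proof -
  have Mp: "clin (M ^^ i)" for i by (rule clin_funpow[OF M])
  obtain \<phi> where \<phi>: "\<And>x y. \<phi> (x + y) = \<phi> x + \<phi> y" "\<And>c x. \<phi> (c *s x) = c * \<phi> x"
    "\<phi> ((M ^^ k) u) = 1" "\<And>w. w \<in> (M ^^ Suc k) ` V \<Longrightarrow> \<phi> w = 0"
    using functional_separating_subspace[OF clin_subspace_image[OF Mp V] u(3)] by metis
  have \<phi>0: "\<phi> 0 = 0" using \<phi>(2)[of 0 0] by simp
  have \<phi>d: "\<phi> (x - y) = \<phi> x - \<phi> y" for x y
    using \<phi>(1)[of "x - y" y] by simp
  have \<phi>s: "\<phi> (\<Sum>i\<in>A. f i) = (\<Sum>i\<in>A. \<phi> (f i))" for f and A :: "nat set"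
    by (induction A rule: infinite_finite_induct) (auto simp: \<phi>0 \<phi>(1))
  have u0: "(M ^^ j) u = 0" if "j > k" for j
  proof -
    have "(M ^^ j) u = (M ^^ (j - Suc k)) ((M ^^ Suc k) u)"
      using that by (simp flip: funpow_add_apply del: funpow.simps)
    then show ?thesis using u(2) by (simp add: clin_0[OF Mp])
  qed
  have \<phi>M0: "\<phi> ((M ^^ Suc k) x) = 0" if "x \<in> V" for x using \<phi>(4) that by blast
  define K where "K = {x\<in>V. \<forall>i\<le>k. \<phi> ((M ^^ i) x) = 0}"
  have cyc\<phi>: "\<phi> ((M ^^ j) (cyc M k u c)) = (\<Sum>i\<le>k. c i * \<phi> ((M ^^ (j + i)) u))" for j c
    by (simp add: cyc_def clin_sum[OF Mp] clin_scale[OF Mp] \<phi>s \<phi>(2) funpow_add)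
  show thesis
  proof (rule that[of K])
    show "vec.subspace K"
      using V by (auto simp: vec.subspace_def K_def clin_0[OF Mp] clin_add[OF Mp] clin_scale[OF Mp] \<phi> \<phi>0)
    show "K \<subseteq> V" by (auto simp: K_def)
    show "u \<notin> K" using \<phi>(3) by (auto simp: K_def)
    show "M x \<in> K" if "x \<in> K" for x
    proof -
      have "\<phi> ((M ^^ i) (M x)) = 0" if i: "i \<le> k" for i
      proof (cases "i = k")
        case True
        then show ?thesis using \<phi>M0[of x] \<open>x \<in> K\<close> by (simp add: K_def funpow_swap1)
      next
        case False
        then have "\<phi> ((M ^^ Suc i) x) = 0" using \<open>x \<in> K\<close> i by (auto simp: K_def simp del: funpow.simps)
        then show ?thesis by (simp add: funpow_swap1)
      qed
      then show ?thesis using that inv by (auto simp: K_def)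
    qed
    show "c i = 0" if "cyc M k u c \<in> K" "i \<le> k" for c i
      using that(2)
    proof (induction i rule: less_induct)
      case (less i)
      \<comment> \<open>Applying \<open>\<phi> \<circ> M ^^ (k - i)\<close> isolates
        \<open>c i\<close>: smaller indices vanish by induction, larger ones because
        \<open>M ^^ Suc k\<close> kills \<open>u\<close>.\<close>
      have "0 = (\<Sum>j\<le>k. c j * \<phi> ((M ^^ (k - i + j)) u))"
        using that(1) cyc\<phi>[of "k - i" c] by (auto simp: K_def)
      also have "\<dots> = (\<Sum>j\<in>{i}. c j * \<phi> ((M ^^ (k - i + j)) u))"
      proof (rule sum.mono_neutral_right)
        show "\<forall>j\<in>{..k} - {i}. c j * \<phi> ((M ^^ (k - i + j)) u) = 0"
        proof
          fix j assume j: "j \<in> {..k} - {i}"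
          show "c j * \<phi> ((M ^^ (k - i + j)) u) = 0"
          proof (cases "j < i")
            case True then show ?thesis using less j by simp
          next
            case False
            then have "k - i + j > k" using j less.prems by auto
            then show ?thesis using u0 \<phi>0 by simp
          qed
        qed
      qed (use less.prems in auto)
      also have "\<dots> = c i" using less.prems \<phi>(3) by simp
      finally show ?case by simp
    qed
    show "\<exists>c. x - cyc M k u c \<in> K" if x: "x \<in> V" for x
    proof -
      \<comment> \<open>Triangular elimination, starting from the functional with index
        \<open>k\<close> and going down: a multiple of \<open>(M ^^ j) u\<close> corrects index
        \<open>k - j\<close> and leaves larger \<open>i\<close> alone, since
        \<open>(M ^^ (i + j)) u = 0\<close> for them.\<close>
      have "\<exists>c. \<forall>i\<le>k. Suc k - j \<le> i \<longrightarrow> \<phi> ((M ^^ i) (x - cyc M k u c)) = 0" if "j \<le> Suc k" for j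
        using that
      proof (induction j)
        case 0 then show ?case by auto
      next
        case (Suc j)
        then obtain c where c: "\<And>i. i \<le> k \<Longrightarrow> Suc k - j \<le> i \<Longrightarrow> \<phi> ((M ^^ i) (x - cyc M k u c)) = 0"
          by auto
        define a where "a = \<phi> ((M ^^ (k - j)) (x - cyc M k u c))"
        define d where "d = (\<lambda>i. c i + (if i = j then a else 0))"
        have cd: "cyc M k u d = cyc M k u c + a *s (M ^^ j) u"
        proof -
          have "cyc M k u d = cyc M k u c + (\<Sum>i\<le>k. (if i = j then a *s (M ^^ j) u else 0))"
            unfolding cyc_def d_def sum.distrib[symmetric]
            by (rule sum.cong) (auto simp: vec.scale_left_distrib)
          then show ?thesis using Suc.prems by simp
        qed
        have "\<phi> ((M ^^ i) (x - cyc M k u d)) = 0" if i: "i \<le> k" "Suc k - Suc j \<le> i" for i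
        proof -
          have e: "\<phi> ((M ^^ i) (x - cyc M k u d))
              = \<phi> ((M ^^ i) (x - cyc M k u c)) - a * \<phi> ((M ^^ (i + j)) u)"
            unfolding cd diff_diff_eq[symmetric]
            by (simp add: clin_diff[OF Mp] clin_scale[OF Mp] \<phi>d \<phi>(2) funpow_add)
          show ?thesis
          proof (cases "i = k - j")
            case True
            then show ?thesis using e \<phi>(3) Suc.prems by (simp add: a_def)
          next
            case False
            then have "Suc k - j \<le> i" "i + j > k" using i Suc.prems by auto
            then show ?thesis using e c[OF i(1)] u0 \<phi>0 by simp
          qed
        qed
        then show ?case by blast
      qed
      from this[of "Suc k"] obtain c where c: "\<forall>i\<le>k. \<phi> ((M ^^ i) (x - cyc M k u c)) = 0" by auto
      have "cyc M k u c \<in> V" unfolding cyc_def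
        by (intro vec.subspace_sum[OF V] vec.subspace_scale[OF V] funpow_in inv u(1))
      then have "x - cyc M k u c \<in> K" using c x V by (simp add: K_def vec.subspace_diff)
      then show ?thesis by blast
    qed
  qed
qed

text \<open>In the basis given by the chain, \<open>N\<close> is a real matrix because
  \<open>l\<close> is real, so conjugating coefficients commutes with \<open>N\<close>; real values
  of \<open>\<phi>\<close> on the chain give compatibility with \<open>\<phi>\<close>.\<close>

lemma real_str_cyclic:
  fixes N :: "complex^'m \<Rightarrow> complex^'m" and l :: real
  assumes N: "clin N"
    and \<phi>: "\<And>x y. \<phi> (x + y) = \<phi> x + \<phi> y" "\<And>c x. \<phi> (c *s x) = c * \<phi> x"
    and M: "\<And>x. M x = N x - complex_of_real l *s x"
    and u: "(M ^^ Suc k) u = 0"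
    and indep: "\<forall>c. cyc M k u c = 0 \<longrightarrow> (\<forall>i\<le>k. c i = 0)"
    and \<phi>u: "\<And>i. i \<le> k \<Longrightarrow> cnj (\<phi> ((M ^^ i) u)) = \<phi> ((M ^^ i) u)"
  shows "\<exists>S. real_str N \<phi> (range (cyc M k u)) S"
    and "\<And>x. x \<in> range (cyc M k u) \<Longrightarrow> N x \<in> range (cyc M k u)"
    and "vec.subspace (range (cyc M k u))"
proof -
  let ?Y = "cyc M k u"
  have Mlin: "clin M" using clin_shift[OF N, of "complex_of_real l"] M by presburger
  have Mp: "clin (M ^^ i)" for i by (rule clin_funpow[OF Mlin])
  have Yadd: "?Y c + ?Y d = ?Y (\<lambda>i. c i + d i)" for c d
    by (simp add: cyc_def vec.scale_left_distrib sum.distrib)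
  have Yscale: "a *s ?Y c = ?Y (\<lambda>i. a * c i)" for a c
    by (simp add: cyc_def vec.scale_sum_right)
  have Y0: "?Y (\<lambda>_. 0) = 0" by (simp add: cyc_def)
  have Ycong: "?Y c = ?Y d" if "\<And>i. i \<le> k \<Longrightarrow> c i = d i" for c d
    unfolding cyc_def by (rule sum.cong) (use that in auto)
  \<comment> \<open>The coefficients of \<open>N (?Y c)\<close>: \<open>M\<close> moves the chain up
    by one place and sends its last vector to 0.\<close>
  define sh where "sh c i = complex_of_real l * c i + (case i of 0 \<Rightarrow> 0 | Suc j \<Rightarrow> c j)" for c i
  have NY: "N (?Y c) = ?Y (sh c)" for c
  proof -
    have "M (?Y c) = (\<Sum>i\<le>k. c i *s (M ^^ Suc i) u)"
      by (simp add: cyc_def clin_sum[OF Mlin] clin_scale[OF Mlin])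
    also have "\<dots> = (\<Sum>i\<le>Suc k. (case i of 0 \<Rightarrow> 0 | Suc j \<Rightarrow> c j) *s (M ^^ i) u)"
      by (subst sum.atMost_Suc_shift) simp
    also have "\<dots> = ?Y (\<lambda>i. case i of 0 \<Rightarrow> 0 | Suc j \<Rightarrow> c j)"
      using u by (simp add: cyc_def)
    finally have "N (?Y c) = complex_of_real l *s ?Y c + ?Y (\<lambda>i. case i of 0 \<Rightarrow> 0 | Suc j \<Rightarrow> c j)"
      by (simp add: M algebra_simps)
    moreover have "sh c = (\<lambda>i. complex_of_real l * c i + (case i of 0 \<Rightarrow> 0 | Suc j \<Rightarrow> c j))"
      by (simp add: sh_def fun_eq_iff)
    ultimately show ?thesis by (simp add: Yscale Yadd)
  qed
  show "N x \<in> range ?Y" if "x \<in> range ?Y" for x using that NY by auto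
  show "vec.subspace (range ?Y)"
    unfolding vec.subspace_def
  proof (intro conjI ballI allI)
    show "0 \<in> range ?Y" using Y0 by (metis rangeI)
  qed (use Yadd Yscale in auto)
  have inj: "c i = d i" if "?Y c = ?Y d" "i \<le> k" for c d i
  proof -
    have "?Y (\<lambda>i. c i + (-1) * d i) = ?Y c + (-1) *s ?Y d"
      by (simp only: Yadd[symmetric] Yscale)
    also have "\<dots> = 0" using that(1) by simp
    finally have "c i + (-1) * d i = 0" using that(2) indep by blast
    then show ?thesis by simp
  qed
  \<comment> \<open>The chosen coefficients are determined only up to \<open>k\<close>, which is all
    that \<open>?Y\<close> reads.\<close>
  define S where "S z = ?Y (\<lambda>i. cnj ((SOME c. z = ?Y c) i))" for z
  have SY: "S (?Y c) = ?Y (\<lambda>i. cnj (c i))" for c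
  proof -
    have "?Y c = ?Y (SOME d. ?Y c = ?Y d)" by (rule someI[of "\<lambda>d. ?Y c = ?Y d" c]) simp
    then show ?thesis unfolding S_def by (intro Ycong) (metis inj)
  qed
  have \<phi>0: "\<phi> 0 = 0" using \<phi>(2)[of 0 0] by simp
  have \<phi>s: "\<phi> (\<Sum>i\<in>A. f i) = (\<Sum>i\<in>A. \<phi> (f i))" for f and A :: "nat set"
    by (induction A rule: infinite_finite_induct) (auto simp: \<phi>0 \<phi>(1))
  have \<phi>Y: "\<phi> (?Y c) = (\<Sum>i\<le>k. c i * \<phi> ((M ^^ i) u))" for c
    by (simp add: cyc_def \<phi>s \<phi>(2))
  have "real_str N \<phi> (range ?Y) S"
    unfolding real_str_def
  proof (intro conjI ballI allI)
    fix z assume "z \<in> range ?Y"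
    then obtain c where z: "z = ?Y c" by blast
    show "S z \<in> range ?Y" by (simp add: z SY)
    show "S (S z) = z" by (simp add: z SY)
    have "(\<lambda>i. cnj (sh c i)) = sh (\<lambda>i. cnj (c i))"
      by (auto simp: sh_def fun_eq_iff split: nat.split)
    then show "S (N z) = N (S z)" by (simp add: z SY NY)
    show "\<phi> (S z) = cnj (\<phi> z)"
      by (simp add: z SY \<phi>Y) (rule sum.cong, auto simp: \<phi>u)
    show "S (a *s z) = cnj a *s S z" for a by (simp add: z SY Yscale)
  next
    fix z z' assume "z \<in> range ?Y" "z' \<in> range ?Y"
    then show "S (z + z') = S z + S z'" by (auto simp: SY Yadd)
  qed
  then show "\<exists>S. real_str N \<phi> (range ?Y) S" by blast
qed

section \<open>Eigenvectors and eigenvalues\<close>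

text \<open>A nonzero polynomial \<open>p\<close> of least degree with \<open>p(N) v = 0\<close> has
  a root \<open>l\<close>; dividing out \<open>X - l\<close> leaves \<open>q\<close> with
  \<open>q(N) v\<close> nonzero, and this vector is an eigenvector for \<open>l\<close>.\<close>

lemma exists_eigenvector:
  fixes N :: "complex^'m \<Rightarrow> complex^'m"
  assumes N: "clin N" and V: "vec.subspace V" and inv: "\<And>x. x \<in> V \<Longrightarrow> N x \<in> V"
    and v: "v \<in> V" "v \<noteq> 0"
  obtains l w where "w \<in> V" "w \<noteq> 0" "N w = l *s w"
proof -
  \<comment> \<open>Horner's scheme: \<open>E p\<close> is \<open>p(N) v\<close>.\<close>
  define E where "E p = fold_coeffs (\<lambda>a w. a *s v + N w) p 0" for p
  have E0: "E 0 = 0" by (simp add: E_def)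
  have EC: "E (pCons a p) = a *s v + N (E p)" for a p
    by (cases "p = 0 \<and> a = 0") (auto simp: E_def clin_0[OF N])
  have Eadd: "E (p + q) = E p + E q" for p q
    by (induction p q rule: poly_induct2)
      (simp_all add: E0 EC clin_add[OF N] vec.scale_left_distrib algebra_simps)
  have Esm: "E (smult c p) = c *s E p" for c p
    by (induction p) (simp_all add: E0 EC clin_scale[OF N] vec.scale_right_distrib)
  have EV: "E p \<in> V" for p
    by (induction p) (use V inv v in \<open>auto simp: E0 EC vec.subspace_0 vec.subspace_add vec.subspace_scale\<close>)
  define w where "w i = (N ^^ i) v" for i
  have Emonom: "E (monom 1 i) = w i" for i
    by (induction i) (simp_all add: monom_0 monom_Suc EC E0 w_def clin_0[OF N])
  \<comment> \<open>The iterates of \<open>v\<close> stay in \<open>V\<close>, so one of them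
    depends on the earlier ones; this yields an annihilating polynomial.\<close>
  have "\<exists>j. w j \<in> vec.span (w ` {..<j})"
  proof (rule ccontr)
    assume "\<nexists>j. w j \<in> vec.span (w ` {..<j})"
    then have nin: "w j \<notin> vec.span (w ` {..<j})" for j by simp
    have "vec.independent (w ` {..<j}) \<and> card (w ` {..<j}) = j" for j
    proof (induction j)
      case 0 then show ?case by (simp add: vec.independent_empty)
    next
      case (Suc j)
      moreover have "w j \<notin> w ` {..<j}" using nin[of j] vec.span_base[of "w j" "w ` {..<j}"] by auto
      ultimately show ?case using nin[of j]
        by (simp add: lessThan_Suc vec.independent_insert)
    qed
    from this[of "Suc (vec.dim V)"] vec.independent_card_le_dim[of "w ` {..<Suc (vec.dim V)}" V]
    show False using funpow_in[of V N, OF inv v(1)] by (fastforce simp: w_def)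
  qed
  then obtain j where j: "w j \<in> vec.span (w ` {..<j})" ..
  \<comment> \<open>Combinations of earlier iterates are values of polynomials of degree below
    \<open>j\<close>, which cannot cancel the leading term of \<open>monom 1 j\<close>.\<close>
  have "vec.span (w ` {..<j}) \<subseteq> E ` {q. \<forall>i\<ge>j. coeff q i = 0}"
  proof (rule vec.span_minimal)
    show "w ` {..<j} \<subseteq> E ` {q. \<forall>i\<ge>j. coeff q i = 0}"
      by (force simp flip: Emonom)
    have "0 \<in> E ` {q. \<forall>i\<ge>j. coeff q i = 0}" using E0 by (force intro: image_eqI[of _ _ 0])
    moreover have "E p + E q \<in> E ` {q. \<forall>i\<ge>j. coeff q i = 0}"
      if "\<forall>i\<ge>j. coeff p i = 0" "\<forall>i\<ge>j. coeff q i = 0" for p q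
      using that by (auto simp flip: Eadd)
    moreover have "c *s E p \<in> E ` {q. \<forall>i\<ge>j. coeff q i = 0}" if "\<forall>i\<ge>j. coeff p i = 0" for c p
      using that by (auto simp flip: Esm)
    ultimately show "vec.subspace (E ` {q. \<forall>i\<ge>j. coeff q i = 0})"
      by (auto simp: vec.subspace_def)
  qed
  then obtain q where q: "w j = E q" "\<forall>i\<ge>j. coeff q i = 0" using j by blast
  have "E (monom 1 j + smult (-1) q) = 0" unfolding Eadd Esm Emonom q(1) by simp
  moreover have "coeff (monom 1 j + smult (-1) q) j = 1" using q(2) by simp
  then have "monom 1 j + smult (-1) q \<noteq> 0" by (metis coeff_0 zero_neq_one)
  ultimately obtain p where p: "p \<noteq> 0" "E p = 0"
    and pmin: "\<And>q. q \<noteq> 0 \<Longrightarrow> E q = 0 \<Longrightarrow> degree p \<le> degree q"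
    using ex_has_least_nat[of "\<lambda>p. p \<noteq> 0 \<and> E p = 0" _ degree] by blast
  have "degree p \<noteq> 0"
  proof
    assume "degree p = 0"
    then obtain a where "p = [:a:]" by (rule degree_eq_zeroE)
    then show False using p v by (simp add: EC E0 clin_0[OF N])
  qed
  then obtain l where "poly p l = 0"
    using fundamental_theorem_of_algebra[of p] by (auto simp: constant_degree)
  then obtain q where q: "p = [:-l, 1:] * q" by (auto simp: poly_eq_0_iff_dvd)
  have q0: "q \<noteq> 0" using p q by auto
  have "degree p = Suc (degree q)" unfolding q using q0 by (subst degree_mult_eq) auto
  then have Eq: "E q \<noteq> 0" using pmin[of q] q0 by auto
  have "p = pCons 0 q + smult (- l) q" using q by simp
  then have "E p = N (E q) - l *s E q" by (simp add: Eadd EC Esm del: smult_minus_left)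
  then show thesis using that[of "E q" l] Eq EV p by simp
qed

text \<open>Eigenvectors of distinct eigenvalues are independent, so the dimension bounds their
  number.\<close>

lemma finite_eigenvalues:
  fixes N :: "complex^'m \<Rightarrow> complex^'m"
  assumes N: "clin N"
  shows "finite {l. \<exists>w. w \<noteq> 0 \<and> N w = l *s w}"
proof -
  let ?L = "{l. \<exists>w. w \<noteq> 0 \<and> N w = l *s w}"
  obtain w where w: "\<And>l. l \<in> ?L \<Longrightarrow> w l \<noteq> 0 \<and> N (w l) = l *s w l"
    using that[of "\<lambda>l. SOME w. w \<noteq> 0 \<and> N w = l *s w"] someI_ex[of "\<lambda>w. w \<noteq> 0 \<and> N w = l *s w" for l]
    by simp
  have indep: "\<forall>l\<in>F. c l = 0" if "finite F" "F \<subseteq> ?L" "(\<Sum>l\<in>F. c l *s w l) = 0" for F c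
    using that
  proof (induction F arbitrary: c rule: finite_induct)
    case empty then show ?case by simp
  next
    case (insert a F)
    \<comment> \<open>Applying \<open>N - a\<close> kills the term at \<open>a\<close> and
      multiplies every other coefficient by the nonzero factor \<open>l - a\<close>.\<close>
    have "(\<Sum>l\<in>F. (c l * (l - a)) *s w l) = N (\<Sum>l\<in>insert a F. c l *s w l) - a *s (\<Sum>l\<in>insert a F. c l *s w l)"
    proof -
      have "N (\<Sum>l\<in>insert a F. c l *s w l) - a *s (\<Sum>l\<in>insert a F. c l *s w l)
          = (\<Sum>l\<in>insert a F. c l *s N (w l) - a *s (c l *s w l))"
        by (simp only: clin_sum[OF N] clin_scale[OF N] vec.scale_sum_right sum_subtractf)
      also have "\<dots> = (\<Sum>l\<in>insert a F. (c l * (l - a)) *s w l)"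
      proof (rule sum.cong)
        fix l assume "l \<in> insert a F"
        then have "N (w l) = l *s w l" using insert.prems w by blast
        then show "c l *s N (w l) - a *s (c l *s w l) = (c l * (l - a)) *s w l"
          by (simp add: vec_eq_iff algebra_simps)
      qed simp
      finally show ?thesis using insert.hyps by simp
    qed
    also have "\<dots> = 0" unfolding insert.prems(2) by (simp add: clin_0[OF N])
    finally have "\<forall>l\<in>F. c l * (l - a) = 0" 
      using insert.IH[of "\<lambda>l. c l * (l - a)"] insert.prems(1) by simp
    then have cF: "\<forall>l\<in>F. c l = 0" using insert.hyps by force
    then have "c a *s w a = 0" using insert.prems(2) insert.hyps by simp
    moreover have "w a \<noteq> 0" using w[of a] insert.prems by blast
    ultimately show ?case using cF by simp
  qed
  have "card F \<le> vec.dim (UNIV :: (complex^'m) set)" if F: "finite F" "F \<subseteq> ?L" for F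
  proof -
    have inj: "inj_on w F"
    proof (rule inj_onI)
      fix l l' assume l: "l \<in> F" "l' \<in> F" "w l = w l'"
      have "N (w l) = l *s w l" "N (w l') = l' *s w l'" "w l \<noteq> 0"
        using w[of l] w[of l'] l(1,2) F(2) by (auto simp del: mem_Collect_eq)
      then show "l = l'" using l(3) by (metis vec.scale_cancel_right)
    qed
    have "vec.independent (w ` F)"
    proof (rule vec.independent_if_scalars_zero)
      fix f x assume "(\<Sum>x\<in>w ` F. f x *s x) = 0" "x \<in> w ` F"
      then show "f x = 0" using indep[OF F, of "f \<circ> w"] by (auto simp: sum.reindex[OF inj])
    qed (use F in simp)
    then show ?thesis
      using vec.independent_card_le_dim[of "w ` F" UNIV] card_image[OF inj] by simp
  qed
  then show ?thesis
    using finite_if_finite_subsets_card_bdd[of ?L "vec.dim (UNIV :: (complex^'m) set)"] by simp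
qed

section \<open>Splitting off Jordan chains when the spectrum is real\<close>

lemma subspace_proper_dim:
  fixes K :: "(complex^'m) set"
  assumes "vec.subspace K" "vec.subspace V" "K \<subseteq> V" "u \<in> V" "u \<notin> K"
  shows "vec.dim K < vec.dim V"
  using assms by (intro vec.dim_psubset) (auto simp: vec.span_eq_iff[THEN iffD2])

text \<open>If \<open>\<phi>\<close> vanishes on \<open>V\<close>, take a longest Jordan chain for some eigenvalue; otherwise take a shortest
  nilpotent chain whose generator is not in the kernel of \<open>\<phi>\<close>.\<close>

lemma jordan_generator:
  fixes N :: "complex^'m \<Rightarrow> complex^'m"
  assumes N: "clin N"
    and \<phi>: "\<And>x y. \<phi> (x + y) = \<phi> x + \<phi> y" "\<And>c x. \<phi> (c *s x) = c * \<phi> x" "\<And>x. \<phi> (N x) = 0"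
    and V: "vec.subspace V" and inv: "\<And>x. x \<in> V \<Longrightarrow> N x \<in> V"
    and real: "\<And>l w. w \<in> V \<Longrightarrow> w \<noteq> 0 \<Longrightarrow> N w = l *s w \<Longrightarrow> l \<in> \<real>"
    and v: "v \<in> V" "v \<noteq> 0"
  obtains l :: real and M u k where "\<And>x. M x = N x - complex_of_real l *s x" "u \<in> V"
    "(M ^^ Suc k) u = 0" "(M ^^ k) u \<notin> (M ^^ Suc k) ` V"
    "\<And>i. cnj (\<phi> ((M ^^ i) u)) = \<phi> ((M ^^ i) u)"
proof (cases "\<forall>x\<in>V. \<phi> x = 0")
  case True
  obtain l w where w: "w \<in> V" "w \<noteq> 0" "N w = l *s w"
    using exists_eigenvector[OF N V inv v] by blast
  obtain r where r: "l = complex_of_real r" using real[OF w] by (auto elim: Reals_cases)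
  define M where "M = (\<lambda>x. N x - l *s x)"
  have Mlin: "clin M" unfolding M_def by (rule clin_shift[OF N])
  have invM: "M x \<in> V" if "x \<in> V" for x
    using that by (simp add: M_def inv V vec.subspace_diff vec.subspace_scale)
  obtain m where m: "\<And>x j. x \<in> V \<Longrightarrow> (M ^^ j) x = 0 \<Longrightarrow> (M ^^ m) x = 0"
    using fitting[OF Mlin V invM] by metis
  \<comment> \<open>\<open>P k\<close>: some Jordan chain for \<open>l\<close> has
    \<open>k + 1\<close> vectors. The Fitting exponent \<open>m\<close> bounds such
    \<open>k\<close>, so a greatest one exists.\<close>
  define P where "P k \<longleftrightarrow> (\<exists>u\<in>V. (M ^^ Suc k) u = 0 \<and> (M ^^ k) u \<noteq> 0)" for k
  have P0: "P 0" using w by (auto simp: P_def M_def)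
  have Pbd: "k < m" if Pk: "P k" for k
  proof (rule ccontr)
    assume "\<not> k < m"
    obtain u where u: "u \<in> V" "(M ^^ Suc k) u = 0" "(M ^^ k) u \<noteq> 0" using Pk by (auto simp: P_def)
    have "(M ^^ k) u = (M ^^ (k - m)) ((M ^^ m) u)"
      using \<open>\<not> k < m\<close> by (simp flip: funpow_add_apply)
    then show False using m[OF u(1,2)] u(3) clin_0[OF clin_funpow[OF Mlin]] by simp
  qed
  define k where "k = (GREATEST k. P k)"
  have Pk: "P k" unfolding k_def by (rule GreatestI_nat[of P 0 m]) (use P0 Pbd in \<open>auto simp: less_imp_le\<close>)
  have nP: "\<not> P (Suc k)"
    using Greatest_le_nat[of P "Suc k" m] Pbd unfolding k_def by (auto simp: less_imp_le)
  obtain u where u: "u \<in> V" "(M ^^ Suc k) u = 0" "(M ^^ k) u \<noteq> 0" using Pk by (auto simp: P_def)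
  show thesis
  proof (rule that[of M r u k])
    show "(M ^^ k) u \<notin> (M ^^ Suc k) ` V"
    proof
      assume "(M ^^ k) u \<in> (M ^^ Suc k) ` V"
      then obtain x where x: "x \<in> V" "(M ^^ k) u = (M ^^ Suc k) x" by blast
      \<comment> \<open>Here \<open>x\<close> would generate a chain longer by one vector.\<close>
      then have "(M ^^ Suc (Suc k)) x = 0" using u(2) by simp
      then show False using nP x u(3) unfolding P_def by metis
    qed
    show "cnj (\<phi> ((M ^^ i) u)) = \<phi> ((M ^^ i) u)" for i
      using True funpow_in[of V M, OF invM u(1)] by simp
  qed (use u r in \<open>auto simp: M_def\<close>)
next
  case False
  then obtain x where x: "x \<in> V" "\<phi> x \<noteq> 0" by blast
  have \<phi>0: "\<phi> 0 = 0" using \<phi>(2)[of 0 0] by simp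
  have \<phi>d: "\<phi> (x - y) = \<phi> x - \<phi> y" for x y using \<phi>(1)[of "x - y" y] by simp
  have \<phi>p: "\<phi> ((N ^^ i) x) = (if i = 0 then \<phi> x else 0)" for i x by (cases i) (auto simp: \<phi>(3))
  note Np = clin_funpow[OF N]
  obtain m where m: "m > 0" "\<And>x. x \<in> V \<Longrightarrow> \<exists>y\<in>V. (N ^^ m) x = (N ^^ m) ((N ^^ m) y)"
    using fitting[OF N V inv] by metis
  obtain y where y: "y \<in> V" "(N ^^ m) x = (N ^^ m) ((N ^^ m) y)" using m(2) x by blast
  define P where "P k \<longleftrightarrow> (\<exists>u\<in>V. (N ^^ k) u = 0 \<and> \<phi> u \<noteq> 0)" for k
  \<comment> \<open>The Fitting component of \<open>x\<close> on which \<open>N\<close> is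
    nilpotent; it has the same \<open>\<phi>\<close> as \<open>x\<close> because
    \<open>\<phi> \<circ> N = 0\<close> and \<open>m > 0\<close>.\<close>
  have "x - (N ^^ m) y \<in> V" using x y V inv by (intro vec.subspace_diff funpow_in)
  moreover have "(N ^^ m) (x - (N ^^ m) y) = 0" using y(2) by (simp add: clin_diff[OF Np])
  moreover have "\<phi> (x - (N ^^ m) y) \<noteq> 0" using x(2) m(1) by (simp add: \<phi>d \<phi>p)
  ultimately have "P m" by (auto simp: P_def)
  then have PL: "P (LEAST k. P k)" by (rule LeastI)
  have "\<not> P 0" using \<phi>0 by (auto simp: P_def)
  then obtain k where k: "(LEAST k. P k) = Suc k" using PL by (metis not0_implies_Suc)
  have nP: "\<not> P k" using k not_less_Least[of k P] by simp
  obtain u where u: "u \<in> V" "(N ^^ Suc k) u = 0" "\<phi> u \<noteq> 0" using PL[unfolded k] by (auto simp only: P_def)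
  define u' where "u' = inverse (\<phi> u) *s u"
  have u': "u' \<in> V" "(N ^^ Suc k) u' = 0" "\<phi> u' = 1"
    using u V by (auto simp: u'_def vec.subspace_scale clin_scale[OF Np] clin_scale[OF N] \<phi>(2) clin_0[OF N])
  show thesis
  \<comment> \<open>The eigenvalue is 0, and \<open>\<phi>\<close> is 1 on the generator and 0 on
    the rest of the chain.\<close>
  proof (rule that[of N 0 u' k])
    show "(N ^^ k) u' \<notin> (N ^^ Suc k) ` V"
    proof
      assume "(N ^^ k) u' \<in> (N ^^ Suc k) ` V"
      then obtain x where x: "x \<in> V" "(N ^^ k) u' = (N ^^ Suc k) x" by blast
      \<comment> \<open>\<open>u' - N x\<close> has the same \<open>\<phi>\<close> as
        \<open>u'\<close> but dies under a smaller power of \<open>N\<close>, against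
        minimality.\<close>
      then have "(N ^^ k) (u' - N x) = 0" by (simp add: clin_diff[OF Np] funpow_swap1)
      moreover have "u' - N x \<in> V" using u' x V inv by (simp add: vec.subspace_diff)
      moreover have "\<phi> (u' - N x) \<noteq> 0" using u' by (simp add: \<phi>d \<phi>(3))
      ultimately show False using nP by (auto simp: P_def)
    qed
    show "cnj (\<phi> ((N ^^ i) u')) = \<phi> ((N ^^ i) u')" for i by (simp add: \<phi>p u')
  qed (use u' in auto)
qed

text \<open>Induction on the dimension: a chain from \<open>jordan_generator\<close> carries a real
  structure by conjugation of coefficients, its complement is \<open>N\<close>-invariant and
  smaller, and the two are glued.\<close>

lemma real_str_real_spectrum:
  fixes N :: "complex^'m \<Rightarrow> complex^'m"
  assumes N: "clin N"
    and \<phi>: "\<And>x y. \<phi> (x + y) = \<phi> x + \<phi> y" "\<And>c x. \<phi> (c *s x) = c * \<phi> x" "\<And>x. \<phi> (N x) = 0"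
    and "vec.subspace V" and "\<And>x. x \<in> V \<Longrightarrow> N x \<in> V"
    and "\<And>l w. w \<in> V \<Longrightarrow> w \<noteq> 0 \<Longrightarrow> N w = l *s w \<Longrightarrow> l \<in> \<real>"
  shows "\<exists>S. real_str N \<phi> V S"
  using assms(5-7)
proof (induction "vec.dim V" arbitrary: V rule: less_induct)
  case less
  note V = less.prems(1) and inv = less.prems(2) and real = less.prems(3)
  show ?case
  proof (cases "V = {0}")
    case True
    have "\<phi> 0 = 0" using \<phi>(2)[of 0 0] by simp
    then have "real_str N \<phi> V (\<lambda>x. x)" using True by (auto simp: real_str_def)
    then show ?thesis by blast
  next
    case False
    then obtain v where v: "v \<in> V" "v \<noteq> 0" using vec.subspace_0[OF V] by auto
    obtain l :: real and M u k where M: "\<And>x. M x = N x - complex_of_real l *s x"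
      and u: "u \<in> V" "(M ^^ Suc k) u = 0" "(M ^^ k) u \<notin> (M ^^ Suc k) ` V"
      and \<phi>u: "\<And>i. cnj (\<phi> ((M ^^ i) u)) = \<phi> ((M ^^ i) u)"
    proof (rule jordan_generator[OF N \<phi> V])
      show "N x \<in> V" if "x \<in> V" for x using inv that .
      show "l \<in> \<real>" if "w \<in> V" "w \<noteq> 0" "N w = l *s w" for l w using real that .
    qed (use v that in auto)
    have Mlin: "clin M" using clin_shift[OF N, of "complex_of_real l"] M by presburger
    have invM: "M x \<in> V" if "x \<in> V" for x
      using that by (simp add: M inv V vec.subspace_diff vec.subspace_scale)
    obtain K where K: "vec.subspace K" "K \<subseteq> V" "u \<notin> K" "\<And>x. x \<in> K \<Longrightarrow> M x \<in> K"
      "\<And>c i. cyc M k u c \<in> K \<Longrightarrow> i \<le> k \<Longrightarrow> c i = 0"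
      "\<And>x. x \<in> V \<Longrightarrow> \<exists>c. x - cyc M k u c \<in> K"
      using cyclic_complement[OF Mlin V invM u] by metis
    have invK: "N x \<in> K" if "x \<in> K" for x
    proof -
      have "N x = M x + complex_of_real l *s x" by (simp add: M)
      then show ?thesis using that K by (simp add: vec.subspace_add vec.subspace_scale)
    qed
    obtain S2 where S2: "real_str N \<phi> K S2"
      using less.hyps[OF subspace_proper_dim[OF K(1) V K(2) u(1) K(3)] K(1) invK] real K(2) by blast
    have indep: "\<forall>c. cyc M k u c = 0 \<longrightarrow> (\<forall>i\<le>k. c i = 0)"
      using K(5) vec.subspace_0[OF K(1)] by simp
    note cyc = real_str_cyclic[OF N \<phi>(1,2) M u(2) indep \<phi>u]
    obtain S1 where S1: "real_str N \<phi> (range (cyc M k u)) S1" using cyc(1) by blast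
    have cycV: "cyc M k u c \<in> V" for c unfolding cyc_def
      by (intro vec.subspace_sum[OF V] vec.subspace_scale[OF V] funpow_in invM u(1))
    show ?thesis
    proof (rule real_str_glue[OF N \<phi>(1) cyc(3) K(1) cyc(2) invK _ _ _ S1 S2])
      show "x = 0" if "x \<in> range (cyc M k u)" "x \<in> K" for x
      proof -
        obtain c where c: "x = cyc M k u c" using \<open>x \<in> range (cyc M k u)\<close> by (rule rangeE)
        then have "c i = 0" if "i \<le> k" for i using K(5) that \<open>x \<in> K\<close> by blast
        then show ?thesis by (simp add: c cyc_def)
      qed
      show "x + y \<in> V" if "x \<in> range (cyc M k u)" "y \<in> K" for x y
        using that cycV K(2) V by (auto intro: vec.subspace_add)
      show "\<exists>x\<in>range (cyc M k u). \<exists>y\<in>K. z = x + y" if z: "z \<in> V" for z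
      proof -
        obtain c where "z - cyc M k u c \<in> K" using K(6)[OF z] by blast
        then show ?thesis by (intro bexI[of _ "cyc M k u c"] bexI[of _ "z - cyc M k u c"]) auto
      qed
    qed
  qed
qed

section \<open>Antilinear maps and pairs of non-real eigenvalues\<close>

definition antilin :: "(complex^'m \<Rightarrow> complex^'n) \<Rightarrow> bool" where
  "antilin T \<longleftrightarrow> (\<forall>x y. T (x + y) = T x + T y) \<and> (\<forall>c x. T (c *s x) = cnj c *s T x)"

lemma antilin_add: "antilin T \<Longrightarrow> T (x + y) = T x + T y"
  and antilin_scale: "antilin T \<Longrightarrow> T (c *s x) = cnj c *s T x"
  by (simp_all add: antilin_def)

lemma antilin_0: "antilin T \<Longrightarrow> T 0 = 0"
  using antilin_scale[of T 0 0] by simp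

lemma antilin_diff: "antilin T \<Longrightarrow> T (x - y) = T x - T y"
  by (metis antilin_add diff_add_cancel add_diff_cancel_right')

text \<open>\<open>S (x + T y) = y + T x\<close> exchanges the generalized eigenspaces of a pair of conjugate non-real
  eigenvalues; it is an involution even when \<open>T\<close> is not.\<close>

lemma real_str_double:
  assumes N: "clin N" and T: "antilin T"
    and V: "vec.subspace V" and inv: "\<And>x. x \<in> V \<Longrightarrow> N x \<in> V"
    and TN: "\<And>x. x \<in> V \<Longrightarrow> T (N x) = N (T x)"
    and disj: "\<And>x. x \<in> V \<Longrightarrow> T x \<in> V \<Longrightarrow> x = 0"
    and \<phi>: "\<And>x y. x \<in> V \<Longrightarrow> y \<in> V \<Longrightarrow> \<phi> (x + T y) = 0"
    and Z: "\<And>x y. x \<in> V \<Longrightarrow> y \<in> V \<Longrightarrow> x + T y \<in> Z"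
      "\<And>z. z \<in> Z \<Longrightarrow> \<exists>x\<in>V. \<exists>y\<in>V. z = x + T y"
  shows "\<exists>S. real_str N \<phi> Z S"
proof -
  define S where "S z = (THE w. \<exists>x\<in>V. \<exists>y\<in>V. z = x + T y \<and> w = y + T x)" for z
  have uniq: "x = x' \<and> y = y'"
    if "x \<in> V" "x' \<in> V" "y \<in> V" "y' \<in> V" "x + T y = x' + T y'" for x x' y y'
  proof -
    have eq: "x - x' = T (y' - y)" using that(5) by (simp add: antilin_diff[OF T] algebra_simps)
    have "x - x' \<in> V" "y' - y \<in> V" using that V by (auto intro: vec.subspace_diff)
    then have "y' - y = 0" using disj eq by metis
    then show ?thesis using eq antilin_0[OF T] by simp
  qed
  have S: "S (x + T y) = y + T x" if "x \<in> V" "y \<in> V" for x y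
    unfolding S_def
  proof (rule the_equality)
    show "\<exists>x'\<in>V. \<exists>y'\<in>V. x + T y = x' + T y' \<and> y + T x = y' + T x'" using that by blast
  next
    fix w assume "\<exists>x'\<in>V. \<exists>y'\<in>V. x + T y = x' + T y' \<and> w = y' + T x'"
    then show "w = y + T x" using uniq that by metis
  qed
  have "real_str N \<phi> Z S"
    unfolding real_str_def
  proof (intro conjI ballI allI)
    fix z assume "z \<in> Z"
    then obtain x y where z: "z = x + T y" "x \<in> V" "y \<in> V" using Z(2) by blast
    have Sz: "S z = y + T x" using S z by simp
    show "S z \<in> Z" using Sz z Z(1) by simp
    show "S (S z) = z" using Sz S z by simp
    have "S (N x + T (N y)) = N y + T (N x)" using S inv z by blast
    then show "S (N z) = N (S z)" using z Sz TN by (simp add: clin_add[OF N])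
    show "\<phi> (S z) = cnj (\<phi> z)" using z Sz \<phi> by simp
    fix c
    have "S (c *s x + T (cnj c *s y)) = cnj c *s y + T (c *s x)"
      using S vec.subspace_scale V z by blast
    then show "S (c *s z) = cnj c *s S z"
      using z Sz by (simp add: vec.scale_right_distrib antilin_scale[OF T])
  next
    fix z z' assume "z \<in> Z" "z' \<in> Z"
    then obtain x y x' y' where z: "z = x + T y" "x \<in> V" "y \<in> V"
      "z' = x' + T y'" "x' \<in> V" "y' \<in> V" using Z(2) by meson
    have "S ((x + x') + T (y + y')) = (y + y') + T (x + x')"
      using S vec.subspace_add V z by blast
    moreover have "z + z' = (x + x') + T (y + y')" using z by (simp add: antilin_add[OF T] algebra_simps)
    ultimately show "S (z + z') = S z + S z'"
      using S z by (simp add: antilin_add[OF T] algebra_simps)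
  qed
  then show ?thesis by blast
qed

text \<open>By induction \<open>N x = l *s x\<close>; on such \<open>x\<close> the second shift is
  multiplication by \<open>l - l'\<close>, no power of which vanishes.\<close>

lemma shift_kernels_disjoint:
  assumes N: "clin N" and "l \<noteq> l'"
    and "((\<lambda>x. N x - l *s x) ^^ i) x = 0" "((\<lambda>x. N x - l' *s x) ^^ j) x = 0"
  shows "x = 0"
  using assms(3,4)
proof (induction i arbitrary: x)
  case 0 then show ?case by simp
next
  case (Suc i)
  let ?M = "\<lambda>x. N x - l *s x" and ?M' = "\<lambda>x. N x - l' *s x"
  have c: "(?M' ^^ j) (?M x) = ?M ((?M' ^^ j) x)" for x
    using funpow_commute[of UNIV ?M' ?M ?M' x j]
    by (simp add: clin_diff[OF N] clin_scale[OF N] vec.scale_right_diff_distrib vec.scale_left_commute algebra_simps)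
  have "?M x = 0"
  proof (rule Suc.IH)
    show "(?M ^^ i) (?M x) = 0" using Suc.prems(1) by (simp only: funpow_Suc_right comp_apply)
    show "(?M' ^^ j) (?M x) = 0"
      unfolding c Suc.prems(2) by (simp add: clin_0[OF N])
  qed
  then have "?M' y = (l - l') *s y" if "y = (l - l') ^ n *s x" for y n
    by (simp add: that clin_scale[OF N] vec_eq_iff algebra_simps)
  then have "(?M' ^^ n) x = (l - l') ^ n *s x" for n
    by (induction n) simp_all
  then show "x = 0" using Suc.prems(2) assms(2) by simp
qed

text \<open>Induction on the dimension. A non-real \<open>l\<close> splits \<open>V\<close> into the
  kernel \<open>Z\<close> and the image \<open>K\<close> of a power of
  \<open>(N - l) (N - cnj l)\<close>: \<open>real_str_double\<close> handles \<open>Z\<close>, and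
  the induction hypothesis handles \<open>K\<close>. Assumptions on \<open>T\<close> over the kernel
  of \<open>\<phi>\<close> suffice, because that kernel contains \<open>Z\<close>.\<close>

lemma real_str_exists:
  fixes N :: "complex^'m \<Rightarrow> complex^'m"
  assumes N: "clin N"
    and \<phi>: "\<And>x y. \<phi> (x + y) = \<phi> x + \<phi> y" "\<And>c x. \<phi> (c *s x) = c * \<phi> x" "\<And>x. \<phi> (N x) = 0"
    and T: "antilin T"
    and "vec.subspace V" and "\<And>x. x \<in> V \<Longrightarrow> N x \<in> V"
    and "\<And>x. x \<in> V \<Longrightarrow> \<phi> x = 0 \<Longrightarrow>
      T x \<in> V \<and> \<phi> (T x) = 0 \<and> T (N x) = N (T x) \<and> (T x = 0 \<longrightarrow> x = 0)"
  shows "\<exists>S. real_str N \<phi> V S"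
  using assms(6-8)
proof (induction "vec.dim V" arbitrary: V rule: less_induct)
  case less
  note V = less.prems(1) and inv = less.prems(2) and TV = less.prems(3)
  show ?case
  proof (cases "\<forall>l w. w \<in> V \<longrightarrow> w \<noteq> 0 \<longrightarrow> N w = l *s w \<longrightarrow> l \<in> \<real>")
    case True
    show ?thesis
      by (rule real_str_real_spectrum[OF N \<phi> V]) (use inv True in auto)
  next
    case False
    then obtain l w where w: "w \<in> V" "w \<noteq> 0" "N w = l *s w" and l: "l \<notin> \<real>" by blast
    define M where "M a = (\<lambda>x. N x - a *s x)" for a
    \<comment> \<open>\<open>T\<close> interchanges the two factors on the kernel of
      \<open>\<phi>\<close>, so \<open>Q\<close> commutes with it there.\<close>
    define Q where "Q = (\<lambda>x. M l (M (cnj l) x))"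
    have ll: "l \<noteq> cnj l" using l Reals_cnj_iff by metis
    have l0: "l \<noteq> 0" using l by auto
    have Mlin: "clin (M a)" for a unfolding M_def by (rule clin_shift[OF N])
    have Qlin: "clin Q" unfolding Q_def by (rule clinI) (simp_all add: clin_add[OF Mlin] clin_scale[OF Mlin])
    have comm: "M a (M b x) = M b (M a x)" for a b x
      by (simp add: M_def clin_diff[OF N] clin_scale[OF N] vec.scale_right_diff_distrib vec.scale_left_commute algebra_simps)
    have NM: "N (M a x) = M a (N x)" for a x
      by (simp add: M_def clin_diff[OF N] clin_scale[OF N])
    have NQ: "N (Q x) = Q (N x)" for x by (simp add: Q_def NM)
    have invM: "M a x \<in> V" if "x \<in> V" for x a
      using that by (simp add: M_def inv V vec.subspace_diff vec.subspace_scale)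
    have invQ: "Q x \<in> V" if "x \<in> V" for x using that by (simp add: Q_def invM)
    have \<phi>d: "\<phi> (x - y) = \<phi> x - \<phi> y" for x y using \<phi>(1)[of "x - y" y] by simp
    have \<phi>M: "\<phi> (M a x) = - a * \<phi> x" for a x by (simp add: M_def \<phi>d \<phi>(2,3))
    have \<phi>Mp: "\<phi> ((M a ^^ n) x) = (- a) ^ n * \<phi> x" for a n x
      by (induction n) (simp_all add: \<phi>M)
    have \<phi>Qp: "\<phi> ((Q ^^ n) x) = (l * cnj l) ^ n * \<phi> x" for n x
      by (induction n) (simp_all add: Q_def \<phi>M)
    have commp: "(M a ^^ i) ((M b ^^ j) x) = (M b ^^ j) ((M a ^^ i) x)" for a b i j x
    proof -
      have 1: "(M a ^^ i) (M b x) = M b ((M a ^^ i) x)" for x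
        using funpow_commute[of UNIV "M a" "M b" "M a" x i] comm by simp
      show ?thesis using funpow_commute[of UNIV "M b" "M a ^^ i" "M b" x j] 1 by simp
    qed
    have Qp: "(Q ^^ n) x = (M l ^^ n) ((M (cnj l) ^^ n) x)" for n x
    proof (induction n)
      case (Suc n)
      then show ?case
        using commp[of 1 "cnj l" n l] by (simp add: Q_def)
    qed simp
    note Mp = clin_funpow[OF Mlin] and Qpl = clin_funpow[OF Qlin]
    \<comment> \<open>Since \<open>\<phi> \<circ> N = 0\<close>, the shift by \<open>a\<close>
      multiplies \<open>\<phi>\<close> by \<open>- a\<close>; generalized eigenvectors for nonzero
      \<open>a\<close> therefore lie in the kernel of \<open>\<phi>\<close>.\<close>
    have ker0: "\<phi> x = 0" if "(M a ^^ n) x = 0" "a \<noteq> 0" for a n x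
      using \<phi>Mp[of n a x] that \<phi>(2)[of 0 0] by simp
    define U where "U = {x\<in>V. \<phi> x = 0}"
    have MU: "M a x \<in> U" if "x \<in> U" for a x using that by (simp add: U_def invM \<phi>M)
    have TU: "T x \<in> U" "T (N x) = N (T x)" "T x = 0 \<Longrightarrow> x = 0" if "x \<in> U" for x
      using TV[of x] that by (auto simp: U_def)
    have TM: "T (M a x) = M (cnj a) (T x)" if "x \<in> U" for a x
      using TU(2)[OF that] by (simp add: M_def antilin_diff[OF T] antilin_scale[OF T])
    have TMp: "T ((M a ^^ n) x) = (M (cnj a) ^^ n) (T x)" if "x \<in> U" for a n x
      by (rule funpow_commute[of U]) (use MU TM that in auto)
    have TQ: "T (Q x) = Q (T x)" if "x \<in> U" for x
      using that MU TM comm by (simp add: Q_def)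
    have QU: "Q x \<in> U" if "x \<in> U" for x using that MU by (simp add: Q_def)
    have TQp: "T ((Q ^^ n) x) = (Q ^^ n) (T x)" if "x \<in> U" for n x
      by (rule funpow_commute[of U]) (use QU TQ that in auto)
    obtain m where m: "m > 0" "\<And>x. x \<in> V \<Longrightarrow> \<exists>y\<in>V. (Q ^^ m) x = (Q ^^ m) ((Q ^^ m) y)"
      "\<And>x j. x \<in> V \<Longrightarrow> (Q ^^ j) x = 0 \<Longrightarrow> (Q ^^ m) x = 0"
      using fitting[OF Qlin V invQ] by metis
    obtain n where n: "n > 0" "\<And>x. x \<in> V \<Longrightarrow> \<exists>y\<in>V. (M l ^^ n) x = (M l ^^ n) ((M l ^^ n) y)"
      "\<And>x j. x \<in> V \<Longrightarrow> (M l ^^ j) x = 0 \<Longrightarrow> (M l ^^ n) x = 0"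
      using fitting[OF Mlin V invM] by metis
    define Z where "Z = {x\<in>V. (Q ^^ m) x = 0}"
    define K where "K = (Q ^^ m) ` V"
    define V1 where "V1 = {x\<in>V. (M l ^^ n) x = 0}"
    define V2 where "V2 = {x\<in>V. (M (cnj l) ^^ n) x = 0}"
    have Zs: "vec.subspace Z" unfolding Z_def by (rule clin_subspace_kernel[OF Qpl V])
    have Ks: "vec.subspace K" unfolding K_def by (rule clin_subspace_image[OF Qpl V])
    have V1s: "vec.subspace V1" unfolding V1_def by (rule clin_subspace_kernel[OF Mp V])
    have V2s: "vec.subspace V2" unfolding V2_def by (rule clin_subspace_kernel[OF Mp V])
    have KV: "K \<subseteq> V" unfolding K_def using funpow_in[of V Q, OF invQ] by blast
    have V1U: "V1 \<subseteq> U" and V2U: "V2 \<subseteq> U" using ker0 l0 by (auto simp: V1_def V2_def U_def)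
    \<comment> \<open>The exponent \<open>n\<close> was chosen for \<open>l\<close>; since
      \<open>T\<close> carries one kernel injectively into the other, it also serves
      \<open>cnj l\<close>.\<close>
    have ker2: "x \<in> V2" if x: "x \<in> V" "(M (cnj l) ^^ j) x = 0" for x j
    proof -
      have xU: "x \<in> U" using ker0[OF x(2)] l0 x(1) by (simp add: U_def)
      then have "(M l ^^ j) (T x) = 0" using TMp[of x j "cnj l"] x(2) antilin_0[OF T] by simp
      then have "(M l ^^ n) (T x) = 0" using n(3) TU(1)[OF xU] by (simp add: U_def)
      then have "T ((M (cnj l) ^^ n) x) = 0" using TMp[OF xU, of n "cnj l"] by simp
      then have "(M (cnj l) ^^ n) x = 0" using TU(3) funpow_in[of U "M (cnj l)", OF MU xU] by blast
      then show ?thesis using x by (simp add: V2_def)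
    qed
    have T12: "T x \<in> V2" if "x \<in> V1" for x
      using TMp[of x n l] that V1U TU(1)[of x] antilin_0[OF T] by (auto simp: V1_def V2_def U_def)
    have T21: "T x \<in> V1" if "x \<in> V2" for x
      using TMp[of x n "cnj l"] that V2U TU(1)[of x] antilin_0[OF T] by (auto simp: V1_def V2_def U_def)
    have disj: "x = 0" if "x \<in> V1" "x \<in> V2" for x
      using shift_kernels_disjoint[OF N ll, of n x n] that by (simp add: V1_def V2_def M_def)
    \<comment> \<open>\<open>T \<circ> T\<close> is linear and injective on \<open>V2\<close>, hence
      onto \<open>V2\<close> by the Fitting argument; its inner \<open>T\<close> lands in
      \<open>V1\<close> and supplies the preimage.\<close>
    have Tsurj: "\<exists>x\<in>V1. T x = y" if y: "y \<in> V2" for y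
    proof -
      define C where "C = (\<lambda>x. T (T x))"
      have Clin: "clin C" unfolding C_def by (rule clinI) (simp_all add: antilin_add[OF T] antilin_scale[OF T])
      have CV: "C x \<in> V2" if "x \<in> V2" for x using that T12 T21 by (simp add: C_def)
      have C0: "x = 0" if "x \<in> V2" "C x = 0" for x
        using that TU(3) T21[of x] V1U V2U unfolding C_def by blast
      have Cp0: "x = 0" if "x \<in> V2" "(C ^^ j) x = 0" for x j
        using that by (induction j) (auto dest!: C0[OF funpow_in[of V2 C, OF CV], rotated])
      obtain j where j: "j > 0" "\<And>x. x \<in> V2 \<Longrightarrow> \<exists>y\<in>V2. (C ^^ j) x = (C ^^ j) ((C ^^ j) y)"
        using fitting[OF Clin V2s CV] by metis
      obtain z where z: "z \<in> V2" "(C ^^ j) y = (C ^^ j) ((C ^^ j) z)" using j(2) y by blast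
      have "(C ^^ j) (y - (C ^^ j) z) = 0" using z(2) by (simp add: clin_diff[OF clin_funpow[OF Clin]])
      moreover have "y - (C ^^ j) z \<in> V2" using y z funpow_in[of V2 C, OF CV] V2s by (simp add: vec.subspace_diff)
      ultimately have "y = (C ^^ j) z" using Cp0 by fastforce
      moreover obtain i where "j = Suc i" using j(1) gr0_implies_Suc by blast
      ultimately have "y = T (T ((C ^^ i) z))" by (simp add: C_def)
      moreover have "T ((C ^^ i) z) \<in> V1" using z funpow_in[of V2 C, OF CV] T21 by blast
      ultimately show ?thesis by blast
    qed
    have V1Z: "V1 \<subseteq> Z"
    proof
      fix x assume "x \<in> V1"
      then have x: "x \<in> V" "(M l ^^ n) x = 0" by (auto simp: V1_def)
      have "(Q ^^ n) x = 0" using x(2) commp[of n l n "cnj l" x] by (simp add: Qp clin_0[OF Mp])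
      then show "x \<in> Z" using x m(3) by (simp add: Z_def)
    qed
    have V2Z: "V2 \<subseteq> Z"
    proof
      fix x assume "x \<in> V2"
      then have x: "x \<in> V" "(M (cnj l) ^^ n) x = 0" by (auto simp: V2_def)
      have "(Q ^^ n) x = 0" using x(2) by (simp add: Qp clin_0[OF Mp])
      then show "x \<in> Z" using x m(3) by (simp add: Z_def)
    qed
    \<comment> \<open>Fitting for \<open>M l\<close> writes \<open>z\<close> as a vector killed by
      \<open>M l ^^ n\<close> plus \<open>(M l ^^ n) y\<close>. Stability of the kernels of powers
      of \<open>M l\<close> shows that \<open>M (cnj l) ^^ m\<close> kills the second part.\<close>
    have Zdec: "\<exists>x\<in>V1. \<exists>y\<in>V2. z = x + y" if z: "z \<in> Z" for z
    proof -
      have zV: "z \<in> V" "(Q ^^ m) z = 0" using z by (auto simp: Z_def)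
      obtain y where y: "y \<in> V" "(M l ^^ n) z = (M l ^^ n) ((M l ^^ n) y)" using n(2) zV by blast
      have My: "(M l ^^ n) y \<in> V" using funpow_in[of V "M l", OF invM y(1)] .
      have "z - (M l ^^ n) y \<in> V1"
        using zV My V y(2) by (simp add: V1_def vec.subspace_diff clin_diff[OF Mp])
      moreover have "(M l ^^ n) y \<in> V2"
      proof (rule ker2[OF My])
        have yV: "(M (cnj l) ^^ m) y \<in> V" using funpow_in[of V "M (cnj l)", OF invM y(1)] .
        have "(M l ^^ (m + (n + n))) ((M (cnj l) ^^ m) y) = (M l ^^ m) ((M (cnj l) ^^ m) ((M l ^^ n) ((M l ^^ n) y)))"
          by (simp only: funpow_add_apply commp[of n l m "cnj l"])
        also have "\<dots> = (M l ^^ n) ((Q ^^ m) z)"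
          unfolding y(2)[symmetric] Qp commp[of n l m "cnj l", symmetric] commp[of m l n l] ..
        also have "\<dots> = 0" by (simp add: zV clin_0[OF Mp])
        finally have "(M l ^^ n) ((M (cnj l) ^^ m) y) = 0" using n(3) yV by blast
        then show "(M (cnj l) ^^ m) ((M l ^^ n) y) = 0" by (simp only: commp[of m "cnj l" n l])
      qed
      ultimately show ?thesis
        by (intro bexI[of _ "z - (M l ^^ n) y"] bexI[of _ "(M l ^^ n) y"]) auto
    qed
    have NV1: "N x \<in> V1" if "x \<in> V1" for x
    proof -
      have "(M l ^^ n) (N x) = N ((M l ^^ n) x)"
        using funpow_commute[of UNIV "M l" N "M l" x n] NM by simp
      then show ?thesis using that inv by (simp add: V1_def clin_0[OF N])
    qed
    have NQp: "N ((Q ^^ m) x) = (Q ^^ m) (N x)" for x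
      using funpow_commute[of UNIV Q N Q x m] NQ by simp
    have NZ: "N x \<in> Z" if "x \<in> Z" for x
      using that inv NQp[of x] by (simp add: Z_def clin_0[OF N])
    have NK: "N x \<in> K" if "x \<in> K" for x using that inv NQp by (auto simp: K_def)
    obtain S1 where S1: "real_str N \<phi> Z S1"
    proof -
      have "\<exists>S. real_str N \<phi> Z S"
      proof (rule real_str_double[OF N T V1s])
        show "x = 0" if "x \<in> V1" "T x \<in> V1" for x
          using disj[OF that(2) T12[OF that(1)]] TU(3) V1U that by blast
        show "\<phi> (x + T y) = 0" if "x \<in> V1" "y \<in> V1" for x y
        proof -
          have "x \<in> U" "T y \<in> U" using that V1U V2U T12[of y] by auto
          then show ?thesis by (simp add: \<phi>(1) U_def)
        qed
        show "x + T y \<in> Z" if "x \<in> V1" "y \<in> V1" for x y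
          using that V1Z V2Z T12[of y] Zs by (auto intro!: vec.subspace_add)
        show "\<exists>x\<in>V1. \<exists>y\<in>V1. z = x + T y" if "z \<in> Z" for z
          using Zdec[OF that] Tsurj by blast
        show "T (N x) = N (T x)" if "x \<in> V1" for x using that TU(2) V1U by blast
      qed (use NV1 in auto)
      then show thesis using that by blast
    qed
    \<comment> \<open>The eigenvector \<open>w\<close> lies in the kernel of \<open>Q\<close>, which
      meets the Fitting image only in 0; so the induction applies to \<open>K\<close>.\<close>
    have "w \<notin> K"
    proof
      assume "w \<in> K"
      then obtain y where y: "y \<in> V" "w = (Q ^^ m) y" by (auto simp: K_def)
      have "M l w = 0" using w(3) by (simp add: M_def)
      then have "Q w = 0" using comm[of l "cnj l" w] by (simp add: Q_def clin_0[OF Mlin])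
      then have "(Q ^^ Suc m) y = 0" using y by simp
      then have "w = 0" using m(3)[OF y(1)] y(2) by blast
      then show False using w by simp
    qed
    then have dimK: "vec.dim K < vec.dim V" by (rule subspace_proper_dim[OF Ks V KV w(1)])
    have TK: "T x \<in> K \<and> \<phi> (T x) = 0 \<and> T (N x) = N (T x) \<and> (T x = 0 \<longrightarrow> x = 0)"
      if x: "x \<in> K" "\<phi> x = 0" for x
    proof -
      obtain y where y: "y \<in> V" "x = (Q ^^ m) y" using x by (auto simp: K_def)
      \<comment> \<open>\<open>Q ^^ m\<close> scales \<open>\<phi>\<close> by a nonzero factor, so
        \<open>y\<close> also lies in the kernel of \<open>\<phi>\<close>, where \<open>T\<close>
        commutes with \<open>Q\<close>.\<close>
      have "\<phi> y = 0" using x(2) l0 by (simp add: y \<phi>Qp)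
      then have yU: "y \<in> U" using y by (simp add: U_def)
      have "T x = (Q ^^ m) (T y)" using TQp[OF yU] y by simp
      then have "T x \<in> K" using TU(1)[OF yU] by (auto simp: K_def U_def)
      then show ?thesis using TV x KV by blast
    qed
    obtain S2 where S2: "real_str N \<phi> K S2"
      using less.hyps[OF dimK Ks NK TK] by blast
    show ?thesis
    proof (rule real_str_glue[OF N \<phi>(1) Zs Ks NZ NK _ _ _ S1 S2])
      show "x = 0" if "x \<in> Z" "x \<in> K" for x
      proof -
        obtain y where y: "y \<in> V" "x = (Q ^^ m) y" using \<open>x \<in> K\<close> by (auto simp: K_def)
        then have "(Q ^^ (m + m)) y = 0" using \<open>x \<in> Z\<close> by (simp add: Z_def funpow_add)
        then show ?thesis using m(3) y by blast
      qed
      show "x + y \<in> V" if "x \<in> Z" "y \<in> K" for x y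
        using that KV V by (auto simp: Z_def intro: vec.subspace_add)
      show "\<exists>x\<in>Z. \<exists>y\<in>K. z = x + y" if z: "z \<in> V" for z
      proof -
        obtain y where y: "y \<in> V" "(Q ^^ m) z = (Q ^^ m) ((Q ^^ m) y)" using m(2) z by blast
        have "(Q ^^ m) y \<in> K" using y by (simp add: K_def)
        moreover from this have "z - (Q ^^ m) y \<in> Z"
          using z KV V y by (auto simp: Z_def clin_diff[OF Qpl] intro: vec.subspace_diff)
        ultimately show ?thesis
          by (intro bexI[of _ "z - (Q ^^ m) y"] bexI[of _ "(Q ^^ m) y"]) auto
      qed
    qed
  qed
qed

section \<open>Reversing antilinear involutions\<close>

text \<open>There are \<open>card F + 1\<close> roots of unity of order dividing
  \<open>card F + 1\<close>, too many to fit into \<open>F\<close>.\<close>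

lemma exists_unimodular_notin_finite:
  assumes "finite F"
  obtains z :: complex where "cmod z = 1" "z \<notin> F"
proof -
  let ?n = "Suc (card F)"
  have "card {z::complex. z ^ ?n = 1} = ?n" by (rule card_roots_unity_eq) simp
  then have "\<not> {z::complex. z ^ ?n = 1} \<subseteq> F"
    using card_mono[OF assms, of "{z. z ^ ?n = 1}"] by auto
  then obtain z where z: "z ^ ?n = 1" "z \<notin> F" by blast
  have "cmod z ^ ?n = 1" using z(1) by (metis norm_power norm_one)
  then have "cmod z = 1" using power_eq_imp_eq_base[of "cmod z" ?n 1] by simp
  then show thesis using that z by blast
qed

text \<open>The Cayley transform \<open>N = c (G - 1) (G - \<zeta>)\<^sup>-\<^sup>1\<close> with \<open>\<zeta> = c\<^sup>2\<close> on the unit circle and not an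
  eigenvalue of \<open>G\<close>: an antilinear map reverses \<open>G\<close> iff it commutes with \<open>N\<close>.\<close>

lemma reversing_antilinear_involution:
  fixes G :: "complex^'m \<Rightarrow> complex^'m"
  assumes G: "clin G"
    and \<phi>: "\<And>x y. \<phi> (x + y) = \<phi> x + \<phi> y" "\<And>c x. \<phi> (c *s x) = c * \<phi> x" "\<And>x. \<phi> (G x) = \<phi> x"
    and T: "antilin T"
    and TG: "\<And>x. \<phi> x = 0 \<Longrightarrow> \<phi> (T x) = 0 \<and> G (T (G x)) = T x \<and> (T x = 0 \<longrightarrow> x = 0)"
  obtains S where "antilin S" "\<And>x. S (S x) = x" "\<And>x. G (S (G x)) = S x"
    "\<And>x. \<phi> (S x) = cnj (\<phi> x)"
proof -
  \<comment> \<open>Adding 1 to the excluded set permits division by \<open>\<zeta> - 1\<close>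
    below.\<close>
  obtain \<zeta> where \<zeta>: "cmod \<zeta> = 1" "\<zeta> \<notin> insert 1 {l. \<exists>w. w \<noteq> 0 \<and> G w = l *s w}"
  proof (rule exists_unimodular_notin_finite)
    show "finite (insert 1 {l. \<exists>w. w \<noteq> 0 \<and> G w = l *s w})"
      using finite_eigenvalues[OF G] by (rule finite.insertI)
  qed
  \<comment> \<open>The factor \<open>c\<close> is a normalisation: without it \<open>T\<close>
    would commute with the transform only up to the scalar \<open>\<zeta>\<close>.\<close>
  define c where "c = csqrt \<zeta>"
  have cc: "c * c = \<zeta>" using power2_csqrt[of \<zeta>] by (simp add: c_def power2_eq_square)
  have "cmod c * cmod c = 1" using \<zeta>(1) by (simp flip: norm_mult add: cc)
  then have "cmod c ^ 2 = 1" by (simp add: power2_eq_square)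
  then have c1: "c * cnj c = 1" by (simp flip: complex_norm_square)
  have c0: "c \<noteq> 0" using c1 by auto
  have z1: "\<zeta> \<noteq> 1" using \<zeta>(2) by simp
  have zc: "\<zeta> * cnj \<zeta> = 1" using c1 by (simp flip: cc add: mult_ac)
  have z0: "\<zeta> \<noteq> 0" using zc by auto
  have ccz: "c * cnj \<zeta> = cnj c" using c1 by (simp flip: cc add: mult.assoc[symmetric])
  have zcc: "\<zeta> * cnj c = c" using c1 by (simp flip: cc add: mult.assoc)
  define X where "X = (\<lambda>x. G x - \<zeta> *s x)"
  have Xlin: "clin X" unfolding X_def by (rule clin_shift[OF G])
  have "x = y" if "X x = X y" for x y
  proof (rule ccontr)
    assume "x \<noteq> y"
    then have "x - y \<noteq> 0" by simp
    moreover have "G (x - y) = \<zeta> *s (x - y)"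
      using that by (simp add: X_def clin_diff[OF G] vec.scale_right_diff_distrib algebra_simps)
    ultimately show False using \<zeta>(2) by blast
  qed
  then have "inj X" by (rule injI)
  then obtain R where R: "clin R" "\<And>x. R (X x) = x" "\<And>x. X (R x) = x"
    using vec.linear_injective_isomorphism[OF Xlin] by auto
  define N where "N = (\<lambda>x. c *s (G (R x) - R x))"
  have Nlin: "clin N" unfolding N_def
    by (rule clinI) (simp_all add: clin_add[OF G] clin_add[OF R(1)] clin_scale[OF G] clin_scale[OF R(1)] vec_eq_iff algebra_simps)
  have \<phi>d: "\<phi> (x - y) = \<phi> x - \<phi> y" for x y using \<phi>(1)[of "x - y" y] by simp
  have \<phi>N: "\<phi> (N x) = 0" for x by (simp add: N_def \<phi>(2,3) \<phi>d)
  have TN: "T (N x) = N (T x)" if "\<phi> x = 0" for x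
  proof -
    define y where "y = R x"
    define a where "a = T (G y)"
    have x: "x = G y - \<zeta> *s y" using R(3)[of x] by (simp add: X_def y_def)
    have "(1 - \<zeta>) * \<phi> y = 0" using that unfolding x by (simp add: \<phi>(2,3) \<phi>d algebra_simps)
    then have "\<phi> y = 0" using z1 by simp
    then have Ga: "G a = T y" using TG a_def by blast
    have "T x = a - cnj \<zeta> *s G a"
      unfolding x by (simp add: Ga antilin_diff[OF T] antilin_scale[OF T] flip: a_def)
    also have "\<dots> = (- cnj \<zeta>) *s X a"
      using zc by (simp add: X_def vec_eq_iff algebra_simps)
    finally have RT: "R (T x) = (- cnj \<zeta>) *s a" by (simp only: clin_scale[OF R(1)] R(2))
    have "N (T x) = (- (c * cnj \<zeta>)) *s (G a - a)"
      unfolding N_def RT clin_scale[OF G] by (simp add: vec_eq_iff algebra_simps)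
    also have "\<dots> = cnj c *s (a - G a)" unfolding ccz by (simp add: vec_eq_iff algebra_simps)
    also have "\<dots> = T (N x)"
      unfolding N_def by (simp add: Ga antilin_diff[OF T] antilin_scale[OF T] flip: y_def a_def)
    finally show ?thesis by simp
  qed
  have "\<exists>S. real_str N \<phi> UNIV S"
  proof (rule real_str_exists[OF Nlin \<phi>(1,2) \<phi>N T vec.subspace_UNIV])
    fix x assume "\<phi> x = 0"
    then show "T x \<in> UNIV \<and> \<phi> (T x) = 0 \<and> T (N x) = N (T x) \<and> (T x = 0 \<longrightarrow> x = 0)"
      using TN[of x] TG[of x] by simp
  qed simp
  then obtain S where S: "real_str N \<phi> UNIV S" by blast
  have anti: "antilin S" using S by (simp add: real_str_def antilin_def)
  have "G (S (G y)) = S y" for y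
  proof -
    \<comment> \<open>Writing \<open>S x\<close> and \<open>S (N x)\<close> in two ways gives two
      linear equations in \<open>a\<close>, \<open>b\<close>, \<open>p\<close> and
      \<open>G p\<close>. Their solution is \<open>a = - \<zeta> p\<close>,
      \<open>b = - \<zeta> (G p)\<close>, hence \<open>b = G a\<close>.\<close>
    define x where "x = X y"
    define p where "p = R (S x)"
    define a where "a = S (G y)"
    define b where "b = S y"
    have 1: "a - cnj \<zeta> *s b = G p - \<zeta> *s p"
    proof -
      have "S x = G p - \<zeta> *s p" using R(3)[of "S x"] by (simp add: p_def X_def)
      moreover have "S x = a - cnj \<zeta> *s b"
        by (simp add: x_def X_def a_def b_def antilin_diff[OF anti] antilin_scale[OF anti])
      ultimately show ?thesis by simp
    qed
    have 2: "cnj c *s (a - b) = c *s (G p - p)"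
    proof -
      have "N x = c *s (G y - y)" by (simp add: N_def x_def R(2))
      then have "S (N x) = cnj c *s (a - b)"
        by (simp add: a_def b_def antilin_diff[OF anti] antilin_scale[OF anti])
      moreover have "S (N x) = N (S x)" using S by (simp add: real_str_def)
      ultimately show ?thesis by (simp add: N_def p_def)
    qed
    have 3: "a - b = \<zeta> *s (G p - p)"
    proof -
      have "c *s (cnj c *s (a - b)) = c *s (c *s (G p - p))" using 2 by simp
      then show ?thesis using c1 cc by simp
    qed
    have 4: "\<zeta> *s a - b = \<zeta> *s (G p - \<zeta> *s p)"
    proof -
      have "\<zeta> *s (a - cnj \<zeta> *s b) = \<zeta> *s a - b" using zc by (simp add: vec.scale_right_diff_distrib)
      then show ?thesis using 1 by simp
    qed
    have "(\<zeta> - 1) *s a = (\<zeta> *s a - b) - (a - b)" by (simp add: vec_eq_iff algebra_simps)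
    also have "\<dots> = (\<zeta> - 1) *s ((- \<zeta>) *s p)" unfolding 3 4 by (simp add: vec_eq_iff algebra_simps)
    finally have a: "a = (- \<zeta>) *s p" using z1 by (simp only: vec.scale_cancel_left) simp
    have "b = a - (a - b)" by simp
    also have "\<dots> = (- \<zeta>) *s G p" unfolding 3 unfolding a by (simp add: vec_eq_iff algebra_simps)
    also have "\<dots> = G a" unfolding a by (rule clin_scale[OF G, symmetric])
    finally show ?thesis by (simp add: a_def b_def)
  qed
  then show thesis using that[of S] anti S by (simp add: real_str_def)
qed

section \<open>The affine group\<close>

lemma cnj_vec_simps:
  "cnj_vec (x + y) = cnj_vec x + cnj_vec y" "cnj_vec (c *s x) = cnj c *s cnj_vec x"
  "cnj_vec (cnj_vec x) = x" "cnj_vec 0 = 0"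
  by (simp_all add: cnj_vec_def vec_eq_iff)

lemma cnj_mat_mult_vec: "cnj_vec (A *v x) = cnj_mat A *v cnj_vec x"
  by (simp add: cnj_vec_def cnj_mat_def vec_eq_iff matrix_vector_mult_def)

lemma cnj_mat_mult: "cnj_mat (A ** B) = cnj_mat A ** cnj_mat B"
  by (simp add: cnj_mat_def vec_eq_iff matrix_matrix_mult_def)

lemma cnj_mat_cnj_mat: "cnj_mat (cnj_mat A) = A"
  by (simp add: cnj_mat_def vec_eq_iff)

lemma cnj_mat_1: "cnj_mat (mat 1) = mat 1"
  by (simp add: cnj_mat_def vec_eq_iff mat_def)

lemma matrix_inv_mult:
  assumes "invertible (A :: complex^'n^'n)"
  shows "A ** matrix_inv A = mat 1" "matrix_inv A ** A = mat 1"
  using someI_ex[OF assms[unfolded invertible_def]] by (simp_all add: matrix_inv_def)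

lemma invertible_cnj_mat: "invertible A \<Longrightarrow> invertible (cnj_mat A)"
  unfolding invertible_def by (metis cnj_mat_mult cnj_mat_1)

lemma aff_mult_assoc: "aff_mult (aff_mult f g) h = aff_mult f (aff_mult g h)"
  by (simp add: aff_mult_def matrix_mul_assoc matrix_vector_mul_assoc matrix_vector_right_distrib add.assoc)

lemma aff_mult_id: "aff_mult aff_id g = g" "aff_mult g aff_id = g"
  by (simp_all add: aff_mult_def aff_id_def)

lemma aff_inv:
  assumes "in_Aff g"
  shows "aff_mult g (aff_inv g) = aff_id" "aff_mult (aff_inv g) g = aff_id"
  using matrix_inv_mult[of "fst g"] assms
  by (simp_all add: in_Aff_def aff_mult_def aff_inv_def aff_id_def matrix_vector_mul_assoc vec.neg)

lemma in_Aff_cnj: "in_Aff g \<Longrightarrow> in_Aff (aff_cnj g)"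
  by (simp add: in_Aff_def aff_cnj_def invertible_cnj_mat)

lemma in_Aff_mult: "in_Aff g \<Longrightarrow> in_Aff h \<Longrightarrow> in_Aff (aff_mult g h)"
  by (simp add: in_Aff_def aff_mult_def invertible_mult)

lemma aff_cnj_mult: "aff_cnj (aff_mult g h) = aff_mult (aff_cnj g) (aff_cnj h)"
  by (simp add: aff_cnj_def aff_mult_def cnj_mat_mult cnj_mat_mult_vec cnj_vec_simps)

lemma aff_cnj_cnj: "aff_cnj (aff_cnj g) = g"
  by (simp add: aff_cnj_def cnj_mat_cnj_mat cnj_vec_simps)

lemma aff_cnj_id: "aff_cnj aff_id = aff_id"
  by (simp add: aff_cnj_def aff_id_def cnj_mat_1 cnj_vec_simps)

section \<open>Coninvolutions and the reversing equation\<close>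

lemma coninvolution_cnj:
  assumes "coninvolution h"
  shows "coninvolution (aff_cnj h)" "aff_mult (aff_cnj h) h = aff_id"
proof -
  have "aff_cnj (aff_mult h (aff_cnj h)) = aff_id" using assms by (simp add: coninvolution_def aff_cnj_id)
  then show "aff_mult (aff_cnj h) h = aff_id" by (simp add: aff_cnj_mult aff_cnj_cnj)
  then show "coninvolution (aff_cnj h)"
    using assms by (simp add: coninvolution_def in_Aff_cnj aff_cnj_cnj)
qed

text \<open>Clearing both inverses gives the form that matches
  \<open>G (S (G x)) = S x\<close>.\<close>

lemma c_reversing_iff:
  assumes g: "in_Aff g" and h: "in_Aff h"
  shows "aff_mult (aff_mult h g) (aff_inv h) = aff_inv (aff_cnj g) \<longleftrightarrow>
    aff_mult (aff_cnj g) (aff_mult h g) = h"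
proof
  assume "aff_mult (aff_mult h g) (aff_inv h) = aff_inv (aff_cnj g)"
  then have "aff_mult (aff_mult (aff_cnj g) (aff_mult (aff_mult h g) (aff_inv h))) h = h"
    by (simp add: aff_inv[OF in_Aff_cnj[OF g]] aff_mult_id)
  then show "aff_mult (aff_cnj g) (aff_mult h g) = h"
    by (simp add: aff_mult_assoc aff_inv[OF h] aff_mult_id)
next
  assume "aff_mult (aff_cnj g) (aff_mult h g) = h"
  then have "aff_mult (aff_inv (aff_cnj g)) (aff_mult (aff_mult (aff_cnj g) (aff_mult h g)) (aff_inv h))
      = aff_inv (aff_cnj g)"
    by (simp add: aff_inv[OF h] aff_mult_id)
  then show "aff_mult (aff_mult h g) (aff_inv h) = aff_inv (aff_cnj g)"
    by (simp add: aff_mult_assoc[symmetric] aff_inv[OF in_Aff_cnj[OF g]] aff_mult_id)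
qed

text \<open>A reversing coninvolution \<open>h\<close> has inverse \<open>aff_cnj h\<close>, so
  \<open>g\<close> is \<open>aff_cnj h\<close> times \<open>h g\<close>, and the reversing equation
  makes \<open>h g\<close> a coninvolution. Conversely, the conjugate of the first factor reverses
  the product.\<close>

lemma strongly_c_reversible_iff_product:
  assumes g: "in_Aff g"
  shows "strongly_c_reversible_aff g \<longleftrightarrow>
    (\<exists>h1 h2. coninvolution h1 \<and> coninvolution h2 \<and> g = aff_mult h1 h2)"
proof
  assume "strongly_c_reversible_aff g"
  then obtain h where h: "coninvolution h"
    and "aff_mult (aff_mult h g) (aff_inv h) = aff_inv (aff_cnj g)"
    unfolding strongly_c_reversible_aff_def by blast
  then have e: "aff_mult (aff_cnj g) (aff_mult h g) = h"
    using c_reversing_iff[OF g, of h] by (simp add: coninvolution_def)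
  have e': "aff_mult g (aff_mult (aff_cnj h) (aff_cnj g)) = aff_cnj h"
    using arg_cong[OF e, of aff_cnj] by (simp add: aff_cnj_mult aff_cnj_cnj)
  have "aff_mult (aff_mult h g) (aff_cnj (aff_mult h g)) = aff_id"
    using h e' by (simp add: aff_cnj_mult aff_mult_assoc coninvolution_def)
  then have "coninvolution (aff_mult h g)"
    using g h by (simp add: coninvolution_def in_Aff_mult)
  moreover have "g = aff_mult (aff_cnj h) (aff_mult h g)"
    using coninvolution_cnj(2)[OF h] by (simp add: aff_mult_assoc[symmetric] aff_mult_id)
  ultimately show "\<exists>h1 h2. coninvolution h1 \<and> coninvolution h2 \<and> g = aff_mult h1 h2"
    using coninvolution_cnj(1)[OF h] by blast
next
  assume "\<exists>h1 h2. coninvolution h1 \<and> coninvolution h2 \<and> g = aff_mult h1 h2"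
  then obtain h1 h2 where h: "coninvolution h1" "coninvolution h2" "g = aff_mult h1 h2" by blast
  have c: "coninvolution (aff_cnj h1)" by (rule coninvolution_cnj[OF h(1)])
  have 1: "aff_mult (aff_cnj h1) g = h2"
    using coninvolution_cnj(2)[OF h(1)] by (simp add: h(3) aff_mult_assoc[symmetric] aff_mult_id)
  have "aff_mult (aff_cnj g) h2 = aff_cnj h1"
    using coninvolution_cnj(2)[OF h(2)] by (simp add: h(3) aff_cnj_mult aff_mult_assoc aff_mult_id)
  then have "aff_mult (aff_mult (aff_cnj h1) g) (aff_inv (aff_cnj h1)) = aff_inv (aff_cnj g)"
    using c_reversing_iff[OF g, of "aff_cnj h1"] c 1 by (simp add: coninvolution_def)
  then show "strongly_c_reversible_aff g" using c unfolding strongly_c_reversible_aff_def by blast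
qed

section \<open>Homogeneous coordinates\<close>

text \<open>\<open>None\<close> indexes the extra coordinate: points of the affine space have value
  1 there, directions have value 0.\<close>

definition homog :: "complex^'n \<Rightarrow> complex \<Rightarrow> complex^('n option)" where
  "homog x a = (\<chi> i. case i of None \<Rightarrow> a | Some j \<Rightarrow> x $ j)"

definition dehomog :: "complex^('n option) \<Rightarrow> complex^'n" where
  "dehomog X = (\<chi> j. X $ Some j)"

lemma homog_None [simp]: "homog x a $ None = a"
  and dehomog_homog [simp]: "dehomog (homog x a) = x"
  and homog_dehomog: "homog (dehomog X) (X $ None) = X"
  by (auto simp: homog_def dehomog_def vec_eq_iff split: option.split)

lemma homog_add: "homog x a + homog y b = homog (x + y) (a + b)"
  and homog_scale: "c *s homog x a = homog (c *s x) (c * a)"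
  by (auto simp: homog_def vec_eq_iff split: option.split)

lemma dehomog_add: "dehomog (X + Y) = dehomog X + dehomog Y"
  and dehomog_scale: "dehomog (c *s X) = c *s dehomog X"
  by (auto simp: dehomog_def vec_eq_iff)

lemma homog_eq_iff [simp]: "homog x a = homog y b \<longleftrightarrow> x = y \<and> a = b"
  by (metis dehomog_homog homog_None)

lemma homog_0: "homog 0 0 = 0"
  by (auto simp: homog_def vec_eq_iff split: option.split)

text \<open>The matrix \<open>B\<close> reverses only directions, which is exactly the input that
  \<open>reversing_antilinear_involution\<close> requires. The resulting \<open>S\<close> acts on
  the hyperplane of points as an anti-affine involution, whose conjugate is the required
  coninvolution.\<close>

lemma c_reversible_GL_imp_strongly:
  fixes g :: "'n::finite aff"
  assumes g: "in_Aff g" and A: "c_reversible_GL (fst g)"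
  shows "strongly_c_reversible_aff g"
proof -
  obtain A v where gAv: "g = (A, v)" by (cases g)
  have invA: "invertible (cnj_mat A)" using g by (simp add: in_Aff_def gAv invertible_cnj_mat)
  obtain B where B: "invertible B" "B ** A ** matrix_inv B = matrix_inv (cnj_mat A)"
    using A by (auto simp: c_reversible_GL_def gAv)
  have "cnj_mat A ** (B ** A ** matrix_inv B) ** B = B"
    unfolding B(2) matrix_inv_mult[OF invA] by simp
  then have BA: "cnj_mat A ** (B ** A) = B"
    by (simp add: matrix_mul_assoc[symmetric] matrix_inv_mult[OF B(1)])
  define G where "G X = homog (A *v dehomog X + (X $ None) *s v) (X $ None)" for X
  \<comment> \<open>The last coordinate is set to 0: a translation part for the reversing map is not
    known yet and comes only from \<open>S\<close>.\<close>
  define T where "T X = homog (cnj_vec (B *v dehomog X)) 0" for X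
  have Gh: "G (homog x a) = homog (A *v x + a *s v) a" for x a by (simp add: G_def)
  have Glin: "clin G"
    by (rule clinI) (simp_all add: G_def homog_add homog_scale dehomog_add dehomog_scale
      matrix_vector_right_distrib vec.scale vec_eq_iff algebra_simps)
  have Tanti: "antilin T"
    by (simp add: antilin_def T_def homog_add homog_scale dehomog_add dehomog_scale
      matrix_vector_right_distrib vec.scale cnj_vec_simps)
  obtain S where S: "antilin S" "\<And>X. S (S X) = X" "\<And>X. G (S (G X)) = S X"
    "\<And>X. S X $ None = cnj (X $ None)"
  proof (rule reversing_antilinear_involution[OF Glin _ _ _ Tanti, of "\<lambda>X. X $ None"])
    fix X :: "complex^('n option)" assume X: "X $ None = 0"
    have "A *v cnj_vec (B *v (A *v x)) = cnj_vec (B *v x)" for x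
    proof -
      have "cnj_vec (cnj_mat A *v (B *v (A *v x))) = cnj_vec (B *v x)"
        unfolding matrix_vector_mul_assoc BA ..
      then show ?thesis by (simp only: cnj_mat_mult_vec cnj_mat_cnj_mat)
    qed
    then have 1: "G (T (G X)) = T X" using X by (simp add: G_def T_def)
    have 2: "X = 0" if "T X = 0"
    proof -
      have "homog (cnj_vec (B *v dehomog X)) 0 = homog 0 0" using that by (simp add: T_def homog_0)
      then have "cnj_vec (cnj_vec (B *v dehomog X)) = 0" by (simp add: cnj_vec_simps)
      then have "B *v dehomog X = 0" by (simp add: cnj_vec_simps)
      then have "(matrix_inv B ** B) *v dehomog X = 0" by (simp flip: matrix_vector_mul_assoc)
      then have "dehomog X = 0" by (simp add: matrix_inv_mult[OF B(1)])
      then show ?thesis using homog_dehomog[of X] X by (simp add: homog_0)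
    qed
    show "T X $ None = 0 \<and> G (T (G X)) = T X \<and> (T X = 0 \<longrightarrow> X = 0)"
      using 1 2 by (simp add: T_def)
  qed (use that in \<open>auto simp: G_def\<close>)
  \<comment> \<open>On points, \<open>S\<close> is the anti-affine map with antilinear part
    \<open>\<tau>\<close> and translation \<open>w\<close>.\<close>
  define \<tau> where "\<tau> x = dehomog (S (homog x 0))" for x
  define w where "w = dehomog (S (homog 0 1))"
  have S0: "S (homog x 0) = homog (\<tau> x) 0" for x
    using homog_dehomog[of "S (homog x 0)"] S(4)[of "homog x 0"] by (simp add: \<tau>_def)
  have S1: "S (homog 0 1) = homog w 1"
    using homog_dehomog[of "S (homog 0 1)"] S(4)[of "homog 0 1"] by (simp add: w_def)
  have Sx1: "S (homog x 1) = homog (\<tau> x + w) 1" for x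
    using antilin_add[OF S(1), of "homog x 0" "homog 0 1"] by (simp add: homog_add S0 S1)
  have \<tau>: "antilin \<tau>"
    unfolding antilin_def \<tau>_def
    using antilin_add[OF S(1), of "homog _ 0" "homog _ 0"] antilin_scale[OF S(1), of _ "homog _ 0"]
    by (simp add: homog_add homog_scale dehomog_add dehomog_scale)
  have \<tau>\<tau>: "\<tau> (\<tau> x) = x" for x using S(2)[of "homog x 0"] by (simp add: S0)
  have \<tau>w: "\<tau> w + w = 0" using S(2)[of "homog 0 1"] by (simp add: S1 Sx1 antilin_0[OF \<tau>])
  have A\<tau>A: "A *v \<tau> (A *v x) = \<tau> x" for x using S(3)[of "homog x 0"] by (simp add: Gh S0)
  have Aw: "A *v (\<tau> v + w) + v = w"
    using S(3)[of "homog 0 1"] by (simp add: Gh S1 Sx1 antilin_0[OF \<tau>])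
  have clin_c\<tau>: "clin (\<lambda>x. cnj_vec (\<tau> x))"
    by (rule clinI) (simp_all add: antilin_add[OF \<tau>] antilin_scale[OF \<tau>] cnj_vec_simps)
  define H where "H = matrix (\<lambda>x. cnj_vec (\<tau> x))"
  have H: "H *v x = cnj_vec (\<tau> x)" for x unfolding H_def by (rule matrix_works[OF clin_c\<tau>])
  have cH: "cnj_mat H *v x = \<tau> (cnj_vec x)" for x
    using cnj_mat_mult_vec[of H "cnj_vec x"] by (simp add: H cnj_vec_simps)
  \<comment> \<open>\<open>h\<close> is complex conjugation after
    \<open>x \<mapsto> \<tau> x + w\<close>: \<open>S \<circ> S = id\<close> makes it a
    coninvolution, and \<open>G \<circ> S \<circ> G = S\<close> gives the reversing
    equation.\<close>
  define h where "h = (H, cnj_vec w)"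
  have HH: "H ** cnj_mat H = mat 1"
    by (simp add: matrix_eq H cH \<tau>\<tau> cnj_vec_simps flip: matrix_vector_mul_assoc)
  have h1: "aff_mult h (aff_cnj h) = aff_id"
    using arg_cong[OF \<tau>w, of cnj_vec]
    by (simp add: h_def aff_mult_def aff_cnj_def aff_id_def HH H cnj_vec_simps)
  have hA: "in_Aff h" using HH by (auto simp: in_Aff_def h_def invertible_right_inverse)
  have "aff_mult (aff_cnj g) (aff_mult h g) = h"
  proof -
    have "cnj_mat A *v cnj_vec (\<tau> (A *v x)) = cnj_vec (\<tau> x)" for x
      using arg_cong[OF A\<tau>A[of x], of cnj_vec] by (simp add: cnj_mat_mult_vec)
    then have "cnj_mat A ** (H ** A) = H"
      by (simp add: matrix_eq H flip: matrix_vector_mul_assoc)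
    moreover have "cnj_mat A *v (H *v v + cnj_vec w) + cnj_vec v = cnj_vec w"
      using arg_cong[OF Aw, of cnj_vec] by (simp add: cnj_mat_mult_vec cnj_vec_simps H)
    ultimately show ?thesis by (simp add: gAv h_def aff_mult_def aff_cnj_def)
  qed
  then have "aff_mult (aff_mult h g) (aff_inv h) = aff_inv (aff_cnj g)"
    using c_reversing_iff[OF g hA] by simp
  then show ?thesis using h1 hA unfolding strongly_c_reversible_aff_def coninvolution_def by blast
qed

theorem theorem1:
  fixes g :: "'n::finite aff"
  assumes "in_Aff g"
  shows "(c_reversible_aff g \<longleftrightarrow> strongly_c_reversible_aff g)
       \<and> (strongly_c_reversible_aff g \<longleftrightarrow>
            (\<exists>h1 h2. coninvolution h1 \<and> coninvolution h2 \<and> g = aff_mult h1 h2))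
       \<and> (c_reversible_aff g \<longleftrightarrow> c_reversible_GL (fst g))"
proof -
  \<comment> \<open>Taking linear parts is a homomorphism compatible with conjugation, so it
    preserves the reversing equation.\<close>
  have "c_reversible_GL (fst g)" if "c_reversible_aff g"
  proof -
    obtain h where h: "in_Aff h" "aff_mult (aff_mult h g) (aff_inv h) = aff_inv (aff_cnj g)"
      using \<open>c_reversible_aff g\<close> unfolding c_reversible_aff_def by blast
    have "fst h ** fst g ** matrix_inv (fst h) = matrix_inv (cnj_mat (fst g))"
      using arg_cong[OF h(2), of fst] by (simp add: aff_mult_def aff_inv_def aff_cnj_def)
    then show ?thesis using h(1) by (auto simp: c_reversible_GL_def in_Aff_def)
  qed
  moreover have "c_reversible_aff g" if "strongly_c_reversible_aff g"
    using that unfolding strongly_c_reversible_aff_def c_reversible_aff_def coninvolution_def by blast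
  ultimately show ?thesis
    using c_reversible_GL_imp_strongly[OF assms] strongly_c_reversible_iff_product[OF assms] by blast
qed

end
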